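(* Let $Q$ be a finite quiver. The skyscraper invariant is finer than the rank invariant on $\mathrm{Rep}(Q)$: if $V,V'\in\mathrm{Rep}(Q)$ satisfy $\delta_V=\delta_{V'}$, then $\rho_V=\rho_{V'}$. More precisely: (1) Let $V\in\mathrm{Rep}(Q)$ be nonzero, let $x\in Q_0$, and let $0=V^0\subsetneq V^1\subsetneq\cdots\subsetneq V^n=V$ be the Harder-Narasimhan filtration of $V$ along the skyscraper central charge $\delta_x$. Then for every vertex $y\geq x$ of $Q$, $$\rho_V(x,y)=\sum_{k=1}^{j}\dim S^k_y,$$ where $S^k:=V^k/V^{k-1}$ and $j$ is the smallest index for which $V^j_x=V_x$. (2) Let $\square$ be the quiver with four vertices $p,q,r,s$ and four edges $p\to q$, $p\to r$, $q\to s$, $r\to s$. There exist two representations $W$ and $W'$ of $\square$ with $\rho_W=\rho_{W'}$ but $\delta_W\neq\delta_{W'}$.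
   Context: Fix a field $\mathbb F$. A quiver $Q$ consists of a finite vertex set $Q_0$, a finite edge set $Q_1$, and source and target maps $s,t:Q_1\to Q_0$ (cycles are allowed here). $\mathrm{Rep}(Q)$ is the abelian category of finite-dimensional representations: $V$ assigns a finite-dimensional $\mathbb F$-vector space $V_x$ to each vertex $x$ and a linear map $V_e:V_{s(e)}\to V_{t(e)}$ to each edge $e$ (no relations imposed). Its dimension vector is $\underline{\dim}_V:Q_0\to\mathbb N$, $x\mapsto\dim V_x$. For vertices $x,y$ write $y\ge x$ if $y=x$ or there is a directed path in $Q$ from $x$ to $y$. A central charge is a function $\alpha:Q_0\to\mathbb R$. The $\alpha$-slope of a nonzero $V$ is $\mu_\alpha(V)=\frac{\sum_{x}\alpha(x)\dim V_x}{\sum_x\dim V_x}$; $V\ne0$ is $\alpha$-semistable if $\mu_\alpha(U)\le\mu_\alpha(V)$ for every nonzero subrepresentation $U\subset V$. Every nonzero $V$ has a unique Harder-Narasimhan (HN) filtration along $\alpha$: a finite filtration $0=V^0\subsetneq V^1\subsetneq\cdots\subsetneq V^n=V$ whose quotients $S^i=V^i/V^{i-1}$ are $\alpha$-semistable with $\mu_\alpha(S^1)>\cdots>\mu_\alpha(S^n)$. The HN type of $V$ along $\alpha$ is the tuple $\mathbf T[V;\alpha]=(\underline{\dim}_{S^1},\ldots,\underline{\dim}_{S^n})$ (the zero representation has the empty tuple as HN type). The skyscraper central charge at $x\in Q_0$ is $\delta_x:Q_0\to\mathbb R$ with $\delta_x(x)=1$ and $\delta_x(y)=0$ for $y\ne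 x$. The skyscraper invariant of $V$ is the collection $\delta_V=\{\mathbf T[V;\delta_x]\mid x\in Q_0\}$, indexed by the vertices. The spanning subrepresentation $\langle V_x\rangle\subset V$ at a vertex $x$ is the intersection of all subrepresentations $W\subset V$ with $W_x=V_x$. The rank invariant of $V$ is $\rho_V:Q_0\times Q_0\to\mathbb N$, $\rho_V(x,y)=\dim\langle V_x\rangle_y$. *)

theory Defs
  imports
    Complex_Main
    "HOL-Algebra.AbelCoset"
    "Graph_Theory.Digraph"
    "Jordan_Normal_Form.Missing_VectorSpace"
begin

text \<open>
  A quiver is a \<^term>\<open>fin_digraph\<close>: finitely many vertices and arcs, with loops, parallel arcs
  and cycles allowed. For vertices, \<open>y \<ge> x\<close> is \<open>x \<rightarrow>\<^sup>*\<^bsub>Q\<^esub> y\<close>, which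
  is reflexive on \<open>verts Q\<close>.
  Vector spaces are carrier-based (\<^term>\<open>vectorspace\<close>), so that subspaces and
  quotients of a representation are again representations of the same kind.
\<close>

record ('v, 'e, 'k, 'b) rep =
  space_at :: "'v \<Rightarrow> ('k, 'b) module"
  map_at :: "'e \<Rightarrow> 'b \<Rightarrow> 'b"

definition quiver_rep ::
  "('k, 'm) ring_scheme \<Rightarrow> ('v, 'e) pre_digraph \<Rightarrow> ('v, 'e, 'k, 'b) rep \<Rightarrow> bool" where
  "quiver_rep K Q V \<longleftrightarrow>
     (\<forall>x\<in>verts Q. vectorspace K (space_at V x) \<and> vectorspace.fin_dim K (space_at V x)) \<and>
     (\<forall>e\<in>arcs Q. linear_map K (space_at V (tail Q e)) (space_at V (head Q e)) (map_at V e))"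

definition nonzero_rep :: "('v, 'e) pre_digraph \<Rightarrow> ('v, 'e, 'k, 'b) rep \<Rightarrow> bool" where
  "nonzero_rep Q V \<longleftrightarrow> (\<exists>x\<in>verts Q. carrier (space_at V x) \<noteq> {\<zero>\<^bsub>space_at V x\<^esub>})"

definition dimension_vector ::
  "('k, 'm) ring_scheme \<Rightarrow> ('v, 'e) pre_digraph \<Rightarrow> ('v, 'e, 'k, 'b) rep \<Rightarrow> 'v \<Rightarrow> nat" where
  "dimension_vector K Q V = (\<lambda>x\<in>verts Q. vectorspace.dim K (space_at V x))"

text \<open>
  A subrepresentation is given by its family of carriers; \<open>sub_rep V U\<close> is the
  corresponding representation.
\<close>

definition subrep ::
  "('k, 'm) ring_scheme \<Rightarrow> ('v, 'e) pre_digraph \<Rightarrow> ('v, 'e, 'k, 'b) rep \<Rightarrow> ('v \<Rightarrow> 'b set) \<Rightarrow> bool" where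
  "subrep K Q V U \<longleftrightarrow>
     (\<forall>x\<in>verts Q. subspace K (U x) (space_at V x)) \<and>
     (\<forall>e\<in>arcs Q. map_at V e ` U (tail Q e) \<subseteq> U (head Q e))"

definition sub_rep ::
  "('v, 'e, 'k, 'b) rep \<Rightarrow> ('v \<Rightarrow> 'b set) \<Rightarrow> ('v, 'e, 'k, 'b) rep" where
  "sub_rep V U =
     \<lparr>space_at = (\<lambda>x. (space_at V x)\<lparr>carrier := U x\<rparr>), map_at = map_at V\<rparr>"

text \<open>
  The quotient vector space, whose elements are the cosets of \<open>N\<close>. The scalar multiple
  \<open>c \<cdot> C\<close> is defined as \<open>c C + N\<close> so that it is right also for \<open>c = 0\<close>. The fields
  \<open>mult\<close> and \<open>one\<close> of a module record are not used.
\<close>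

definition quotient_space ::
  "('k, 'b) module \<Rightarrow> 'b set \<Rightarrow> ('k, 'b set) module" where
  "quotient_space M N =
     \<lparr>carrier = a_rcosets\<^bsub>M\<^esub> N,
      mult = (\<lambda>_ _. N),
      one = N,
      zero = N,
      add = (\<lambda>A B. A <+>\<^bsub>M\<^esub> B),
      smult = (\<lambda>c C. \<Union>v\<in>C. N +>\<^bsub>M\<^esub> (c \<odot>\<^bsub>M\<^esub> v))\<rparr>"

definition quotient_rep ::
  "('v, 'e) pre_digraph \<Rightarrow> ('v, 'e, 'k, 'b) rep \<Rightarrow> ('v \<Rightarrow> 'b set) \<Rightarrow> ('v, 'e, 'k, 'b set) rep" where
  "quotient_rep Q V U =
     \<lparr>space_at = (\<lambda>x. quotient_space (space_at V x) (U x)),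
      map_at = (\<lambda>e C. \<Union>v\<in>C. U (head Q e) +>\<^bsub>space_at V (head Q e)\<^esub> map_at V e v)\<rparr>"

definition slope ::
  "('k, 'm) ring_scheme \<Rightarrow> ('v, 'e) pre_digraph \<Rightarrow> ('v \<Rightarrow> real) \<Rightarrow> ('v, 'e, 'k, 'b) rep \<Rightarrow> real" where
  "slope K Q \<alpha> V =
     (\<Sum>x\<in>verts Q. \<alpha> x * real (dimension_vector K Q V x)) /
     (\<Sum>x\<in>verts Q. real (dimension_vector K Q V x))"

definition semistable ::
  "('k, 'm) ring_scheme \<Rightarrow> ('v, 'e) pre_digraph \<Rightarrow> ('v \<Rightarrow> real) \<Rightarrow> ('v, 'e, 'k, 'b) rep \<Rightarrow> bool" where
  "semistable K Q \<alpha> V \<longleftrightarrow>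
     nonzero_rep Q V \<and>
     (\<forall>U. subrep K Q V U \<longrightarrow> nonzero_rep Q (sub_rep V U) \<longrightarrow>
        slope K Q \<alpha> (sub_rep V U) \<le> slope K Q \<alpha> V)"

definition filtration_quotient ::
  "('v, 'e) pre_digraph \<Rightarrow> ('v, 'e, 'k, 'b) rep \<Rightarrow> (nat \<Rightarrow> 'v \<Rightarrow> 'b set) \<Rightarrow> nat \<Rightarrow>
    ('v, 'e, 'k, 'b set) rep" where
  "filtration_quotient Q V F k = quotient_rep Q (sub_rep V (F k)) (F (k - 1))"

text \<open>For the zero representation this forces \<open>n = 0\<close>, hence the empty HN type below.\<close>

definition HN_filtration ::
  "('k, 'm) ring_scheme \<Rightarrow> ('v, 'e) pre_digraph \<Rightarrow> ('v \<Rightarrow> real) \<Rightarrow> ('v, 'e, 'k, 'b) rep \<Rightarrow>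
    nat \<Rightarrow> (nat \<Rightarrow> 'v \<Rightarrow> 'b set) \<Rightarrow> bool" where
  "HN_filtration K Q \<alpha> V n F \<longleftrightarrow>
     (\<forall>k\<le>n. subrep K Q V (F k)) \<and>
     (\<forall>x\<in>verts Q. F 0 x = {\<zero>\<^bsub>space_at V x\<^esub>}) \<and>
     (\<forall>x\<in>verts Q. F n x = carrier (space_at V x)) \<and>
     (\<forall>k\<in>{1..n}. (\<forall>x\<in>verts Q. F (k - 1) x \<subseteq> F k x) \<and> (\<exists>x\<in>verts Q. F (k - 1) x \<noteq> F k x)) \<and>
     (\<forall>k\<in>{1..n}. semistable K Q \<alpha> (filtration_quotient Q V F k)) \<and>
     (\<forall>k\<in>{1..<n}. slope K Q \<alpha> (filtration_quotient Q V F k) >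
                    slope K Q \<alpha> (filtration_quotient Q V F (k + 1)))"

definition HN_type ::
  "('k, 'm) ring_scheme \<Rightarrow> ('v, 'e) pre_digraph \<Rightarrow> ('v \<Rightarrow> real) \<Rightarrow> ('v, 'e, 'k, 'b) rep \<Rightarrow>
    ('v \<Rightarrow> nat) list" where
  "HN_type K Q \<alpha> V =
     (THE T. \<exists>n F. HN_filtration K Q \<alpha> V n F \<and>
        T = map (\<lambda>k. dimension_vector K Q (filtration_quotient Q V F k)) [1..<n + 1])"

definition skyscraper :: "'v \<Rightarrow> 'v \<Rightarrow> real" where
  "skyscraper x y = (if y = x then 1 else 0)"

definition skyscraper_invariant ::
  "('k, 'm) ring_scheme \<Rightarrow> ('v, 'e) pre_digraph \<Rightarrow> ('v, 'e, 'k, 'b) rep \<Rightarrow>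
    'v \<Rightarrow> ('v \<Rightarrow> nat) list" where
  "skyscraper_invariant K Q V = (\<lambda>x\<in>verts Q. HN_type K Q (skyscraper x) V)"

definition spanning_subrep ::
  "('k, 'm) ring_scheme \<Rightarrow> ('v, 'e) pre_digraph \<Rightarrow> ('v, 'e, 'k, 'b) rep \<Rightarrow> 'v \<Rightarrow> 'v \<Rightarrow> 'b set" where
  "spanning_subrep K Q V x =
     (\<lambda>y. \<Inter>{W y | W. subrep K Q V W \<and> W x = carrier (space_at V x)})"

definition rank_invariant ::
  "('k, 'm) ring_scheme \<Rightarrow> ('v, 'e) pre_digraph \<Rightarrow> ('v, 'e, 'k, 'b) rep \<Rightarrow> 'v \<times> 'v \<Rightarrow> nat" where
  "rank_invariant K Q V =
     (\<lambda>(x, y)\<in>verts Q \<times> verts Q. dimension_vector K Q (sub_rep V (spanning_subrep K Q V x)) y)"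

datatype square_vertex = Vp | Vq | Vr | Vs

definition square_quiver :: "(square_vertex, square_vertex \<times> square_vertex) pre_digraph" where
  "square_quiver =
     \<lparr>verts = {Vp, Vq, Vr, Vs},
      arcs = {(Vp, Vq), (Vp, Vr), (Vq, Vs), (Vr, Vs)},
      tail = fst,
      head = snd\<rparr>"

end

theory Submission
  imports Defs
begin

text \<open>
  Dimension vectors make the subrepresentations of \<open>V\<close> a modular lattice with a rank
  (total dimension) and a degree (\<open>\<alpha>\<close>-weighted dimension). For every real \<open>t\<close>, the step
  of the Harder-Narasimhan filtration that collects the slopes above \<open>t\<close> is the least
  subrepresentation maximizing \<open>degree - t * rank\<close>; this determines the filtration. For
  \<open>\<alpha> = skyscraper x\<close> and \<open>t = 0\<close>, the maximizers are the subrepresentations containing the whole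
  space at \<open>x\<close>, so the least one is the spanning subrepresentation at \<open>x\<close>, and it is the first step
  of the filtration that exhausts the space at \<open>x\<close>.

  For the square, let the space at \<open>p\<close> be a plane mapping onto lines at \<open>q\<close> and \<open>r\<close>. The rank
  invariant does not see whether the two kernels coincide. If they do, the common kernel is a
  subrepresentation of slope \<open>1\<close> along \<open>skyscraper p\<close>; otherwise the representation is semistable.
\<close>

section \<open>Subspaces and quotient spaces\<close>

text \<open>The classical uniqueness proof for Harder-Narasimhan filtrations studies morphisms
  between semistable objects. Here it is replaced by numbers attached to the subobjects of one fixed
  \<open>V\<close>; the layers, which live in types of cosets, enter only where semistability of B/A
  is turned into a condition on the subrepresentations between A and B. Existence and uniqueness are
  both proved, because \<open>HN_type\<close> is a definite description.

  That equal skyscraper invariants give equal rank invariants needs one thing beyond the sum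
  formula: the number of summands must be visible in the type. It is, because the space at x is
  exhausted exactly when the partial sums of the dimensions at x reach their total.

  Both representations of the square have coordinate spaces at the vertices and coordinate
  projections along the arrows. All arrows are then surjective, so the rank invariant only depends
  on reachability and on the sizes of the index sets. The skyscraper invariants are separated by the
  length of a single type, without computing either type.\<close>

lemma subspace_inter: "subspace K A W \<Longrightarrow> subspace K B W \<Longrightarrow> subspace K (A \<inter> B) W"
  by (auto simp: subspace_def submodule_def)

lemma (in vectorspace) subspace_of_subspace_iff:
  assumes "subspace K B V"
  shows "subspace K A (vs B) \<longleftrightarrow> subspace K A V \<and> A \<subseteq> B"
proof -
  have "vectorspace K (vs B)" using assms by (rule subspace_is_vs)
  moreover have "module K (vs B)" using calculation by (simp add: vectorspace_def)
  moreover have "vectorspace K V" ..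
  moreover have "module K V" ..
  moreover have "B \<subseteq> carrier V" using assms by (simp add: subspace_def submodule_def)
  ultimately show ?thesis
    by (auto simp: subspace_def submodule_def)
qed

text \<open>Independence in \<open>W\<close> implies independence in \<open>V\<close>, so
  independent subsets of \<open>W\<close> have bounded size; a maximal one exists and is a
  basis.\<close>

lemma (in vectorspace) subspace_fin_dim:
  assumes "subspace K W V" and fin_dim
  shows "vectorspace.fin_dim K (vs W)"
proof -
  interpret W: vectorspace K "vs W" using assms(1) by (rule subspace_is_vs)
  have sub: "W \<subseteq> carrier V" and subm: "submodule K W V"
    using assms(1) by (auto simp: subspace_def submodule_def)
  let ?P = "\<lambda>S. S \<subseteq> W \<and> W.lin_indpt S"
  have bound: "finite S \<and> card S \<le> dim" if "?P S" for S
  proof -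
    have "lin_indpt S" using that subm span_li_not_depend(2)[of S W] by simp
    then show ?thesis using that sub assms(2) li_le_dim[of S] by blast
  qed
  have "?P {}" by (auto simp: W.lin_dep_def)
  then obtain S where S: "finite S" "maximal S ?P"
    using maximal_exists[of ?P dim "{}"] bound by blast
  then have "W.basis S" using W.max_li_is_basis[of S] by simp
  then show ?thesis using S(1) unfolding W.fin_dim_def W.basis_def by auto
qed

lemma (in linear_map) linear_map_restrict:
  assumes "subspace K C V"
  shows "linear_map K (V.vs C) W T"
proof -
  have "C \<subseteq> carrier V" using assms by (simp add: subspace_def submodule_def)
  then have "T \<in> module_hom K (V.vs C) W"
    by (auto simp: module_hom_def subset_iff)
  moreover have "vectorspace K (V.vs C)" using assms by (rule V.subspace_is_vs)
  ultimately show ?thesis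
    by (simp add: linear_map_def mod_hom_def mod_hom_axioms_def vectorspace_def W.vectorspace_axioms W.module.module_axioms)
qed

lemma (in linear_map) subspace_image:
  assumes "subspace K C V"
  shows "subspace K (T ` C) W"
proof -
  interpret C: linear_map K "V.vs C" W T using assms by (rule linear_map_restrict)
  show ?thesis using C.imT_is_subspace by (simp add: C.im_def)
qed

lemma (in linear_map) subspace_preimage:
  assumes "subspace K C W"
  shows "subspace K {v \<in> carrier V. T v \<in> C} V"
proof -
  have "submodule K C W" using assms by (simp add: subspace_def)
  then show ?thesis
    using V.vectorspace_axioms V.module.module_axioms
    by (auto simp: subspace_def submodule_def)
qed

text \<open>Rank-nullity for the restriction of \<open>T\<close> to \<open>C\<close>. The dimension
  counts for quotients, sums, coordinate spaces and the square all go through it.\<close>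

lemma (in linear_map) dim_image:
  assumes "subspace K C V" and "V.fin_dim"
  shows "vectorspace.dim K (V.vs C) =
    vectorspace.dim K (W.vs (T ` C)) + vectorspace.dim K (V.vs {v \<in> C. T v = \<zero>\<^bsub>W\<^esub>})"
proof -
  interpret C: linear_map K "V.vs C" W T using assms(1) by (rule linear_map_restrict)
  have "C.V.fin_dim" using V.subspace_fin_dim assms by blast
  from C.rank_nullity[OF this] show ?thesis
    by (simp add: C.im_def C.ker_def)
qed

section \<open>Dimensions of subspaces\<close>

lemma (in vectorspace) subspace_zero: "subspace K {\<zero>\<^bsub>V\<^esub>} V"
  using vectorspace_axioms module_axioms by (auto simp: subspace_def submodule_def)

lemma (in vectorspace) subspace_carrier: "subspace K (carrier V) V"
  using vectorspace_axioms module_axioms by (auto simp: subspace_def submodule_def)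

lemma (in vectorspace) dim_zero_space: "vectorspace.dim K (vs {\<zero>\<^bsub>V\<^esub>}) = 0"
proof -
  interpret Z: vectorspace K "vs {\<zero>\<^bsub>V\<^esub>}" using subspace_zero by (rule subspace_is_vs)
  have "Z.basis {}" 
    by (auto simp: Z.basis_def Z.span_empty Z.lin_dep_def)
  from Z.dim_basis[OF _ this] show ?thesis by simp
qed

lemma (in vectorspace) zero_in_subspace: "subspace K A V \<Longrightarrow> \<zero>\<^bsub>V\<^esub> \<in> A"
  by (simp add: subspace_def submodule_def)

lemma (in vectorspace) subspace_subset_carrier: "subspace K A V \<Longrightarrow> A \<subseteq> carrier V"
  by (simp add: subspace_def submodule_def)

lemma (in vectorspace) carrier_eq_if_dim_zero:
  assumes fin_dim and "dim = 0"
  shows "carrier V = {\<zero>\<^bsub>V\<^esub>}"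
proof -
  obtain S where "finite S" "basis S" using finite_basis_exists assms(1) by blast
  then show ?thesis using dim_basis[of S] assms(2) by (auto simp: basis_def span_empty)
qed

text \<open>A basis of \<open>A\<close> is independent in \<open>V\<close> and has at least
  \<open>dim\<close> elements, hence is a basis of \<open>V\<close>.\<close>

lemma (in vectorspace) subspace_eq_if_dim_eq:
  assumes "subspace K A V" and fin_dim and "dim \<le> vectorspace.dim K (vs A)"
  shows "A = carrier V"
proof -
  interpret A: vectorspace K "vs A" using assms(1) by (rule subspace_is_vs)
  have sub: "A \<subseteq> carrier V" and subm: "submodule K A V"
    using assms(1) by (auto simp: subspace_def submodule_def)
  have "A.fin_dim" using assms subspace_fin_dim by blast
  then obtain S where S: "finite S" "A.basis S" using A.finite_basis_exists by blast
  then have SA: "S \<subseteq> A" and "A.lin_indpt S" and "A.span S = A" by (auto simp: A.basis_def)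
  then have "lin_indpt S" and "span S = A"
    using subm span_li_not_depend[of S A] by auto
  moreover have "dim \<le> card S" using A.dim_basis S assms(3) by simp
  ultimately have "basis S" using dim_li_is_basis[of S] assms(2) S(1) SA sub by blast
  then show ?thesis using \<open>span S = A\<close> by (simp add: basis_def)
qed

lemma (in vectorspace) subspace_dim_le:
  assumes "subspace K A V" and fin_dim
  shows "vectorspace.dim K (vs A) \<le> dim"
proof -
  interpret A: vectorspace K "vs A" using assms(1) by (rule subspace_is_vs)
  have sub: "A \<subseteq> carrier V" and subm: "submodule K A V"
    using assms(1) by (auto simp: subspace_def submodule_def)
  have "A.fin_dim" using assms subspace_fin_dim by blast
  then obtain S where S: "finite S" "A.basis S" using A.finite_basis_exists by blast
  then have SA: "S \<subseteq> A" and "A.lin_indpt S" by (auto simp: A.basis_def)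
  then have "lin_indpt S" using subm span_li_not_depend(2)[of S A] by auto
  then show ?thesis using A.dim_basis[OF S] li_le_dim(2)[of S] assms(2) SA sub by auto
qed

lemma (in vectorspace) subspace_dim_mono:
  assumes A: "subspace K A V" and B: "subspace K B V" and "A \<subseteq> B" and fin_dim
  shows "vectorspace.dim K (vs A) \<le> vectorspace.dim K (vs B)"
    and "vectorspace.dim K (vs A) = vectorspace.dim K (vs B) \<Longrightarrow> A = B"
proof -
  interpret B: vectorspace K "vs B" using B by (rule subspace_is_vs)
  have A': "subspace K A (vs B)" using subspace_of_subspace_iff[OF B] A assms(3) by simp
  have "B.fin_dim" using B assms(4) by (rule subspace_fin_dim)
  then show "vectorspace.dim K (vs A) \<le> vectorspace.dim K (vs B)"
    and "vectorspace.dim K (vs A) = vectorspace.dim K (vs B) \<Longrightarrow> A = B"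
    using B.subspace_dim_le[OF A'] B.subspace_eq_if_dim_eq[OF A'] by simp_all
qed

text \<open>All that is assumed of \<open>W\<close> is that \<open>T\<close> maps onto it and
  carries the operations over, so each vector space axiom is an identity of \<open>V\<close> pushed
  forward along \<open>T\<close>. It serves the quotient space, whose axioms would otherwise be
  checked on cosets.\<close>

lemma (in vectorspace) vectorspace_surjective_image:
  fixes W :: "('a, 'x, 'y) module_scheme"
  assumes "T ` carrier V = carrier W"
    and zero: "T \<zero>\<^bsub>V\<^esub> = \<zero>\<^bsub>W\<^esub>"
    and add: "\<And>v w. v \<in> carrier V \<Longrightarrow> w \<in> carrier V \<Longrightarrow> T v \<oplus>\<^bsub>W\<^esub> T w = T (v \<oplus>\<^bsub>V\<^esub> w)"
    and smult: "\<And>c v. c \<in> carrier K \<Longrightarrow> v \<in> carrier V \<Longrightarrow> c \<odot>\<^bsub>W\<^esub> T v = T (c \<odot>\<^bsub>V\<^esub> v)"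
  shows "linear_map K V W T"
proof -
  have sur: "\<exists>v\<in>carrier V. w = T v" if "w \<in> carrier W" for w using that assms(1) by blast
  have mem: "T v \<in> carrier W" if "v \<in> carrier V" for v using that assms(1) by blast
  have "vectorspace K W"
  proof (rule vs_criteria)
    show "field K" ..
    show "\<zero>\<^bsub>W\<^esub> \<in> carrier W" unfolding zero[symmetric] by (rule mem) simp
    show "\<forall>v w. v \<in> carrier W \<and> w \<in> carrier W \<longrightarrow> v \<oplus>\<^bsub>W\<^esub> w \<in> carrier W"
      by (auto dest!: sur simp: add mem)
    show "\<forall>v\<in>carrier W. \<exists>neg_v\<in>carrier W. v \<oplus>\<^bsub>W\<^esub> neg_v = \<zero>\<^bsub>W\<^esub>"
    proof
      fix w assume "w \<in> carrier W"
      then obtain v where v: "v \<in> carrier V" "w = T v" using sur by blast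
      then have "w \<oplus>\<^bsub>W\<^esub> T (\<ominus>\<^bsub>V\<^esub> v) = \<zero>\<^bsub>W\<^esub>" by (simp add: add zero M.r_neg)
      then show "\<exists>neg_v\<in>carrier W. w \<oplus>\<^bsub>W\<^esub> neg_v = \<zero>\<^bsub>W\<^esub>" using v mem by auto
    qed
    show "\<forall>c v. c \<in> carrier K \<and> v \<in> carrier W \<longrightarrow> c \<odot>\<^bsub>W\<^esub> v \<in> carrier W"
      by (auto dest!: sur simp: smult mem)
    show "\<forall>v w. v \<in> carrier W \<and> w \<in> carrier W \<longrightarrow> v \<oplus>\<^bsub>W\<^esub> w = w \<oplus>\<^bsub>W\<^esub> v"
      by (auto dest!: sur simp: add M.a_comm)
    show "\<forall>v w x. v \<in> carrier W \<and> w \<in> carrier W \<and> x \<in> carrier W \<longrightarrow>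
        v \<oplus>\<^bsub>W\<^esub> w \<oplus>\<^bsub>W\<^esub> x = v \<oplus>\<^bsub>W\<^esub> (w \<oplus>\<^bsub>W\<^esub> x)"
      by (auto dest!: sur simp: add M.a_assoc)
    show "\<forall>v\<in>carrier W. v \<oplus>\<^bsub>W\<^esub> \<zero>\<^bsub>W\<^esub> = v"
      by (auto dest!: sur simp: zero[symmetric] add)
    show "\<forall>a b v. a \<in> carrier K \<and> b \<in> carrier K \<and> v \<in> carrier W \<longrightarrow>
        a \<otimes>\<^bsub>K\<^esub> b \<odot>\<^bsub>W\<^esub> v = a \<odot>\<^bsub>W\<^esub> (b \<odot>\<^bsub>W\<^esub> v)"
      by (auto dest!: sur simp: smult smult_assoc1)
    show "\<forall>v\<in>carrier W. \<one>\<^bsub>K\<^esub> \<odot>\<^bsub>W\<^esub> v = v"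
      by (auto dest!: sur simp: smult)
    show "\<forall>a b v. a \<in> carrier K \<and> b \<in> carrier K \<and> v \<in> carrier W \<longrightarrow>
        (a \<oplus>\<^bsub>K\<^esub> b) \<odot>\<^bsub>W\<^esub> v = a \<odot>\<^bsub>W\<^esub> v \<oplus>\<^bsub>W\<^esub> b \<odot>\<^bsub>W\<^esub> v"
      by (auto dest!: sur simp: smult add smult_l_distr)
    show "\<forall>a v w. a \<in> carrier K \<and> v \<in> carrier W \<and> w \<in> carrier W \<longrightarrow>
        a \<odot>\<^bsub>W\<^esub> (v \<oplus>\<^bsub>W\<^esub> w) = a \<odot>\<^bsub>W\<^esub> v \<oplus>\<^bsub>W\<^esub> a \<odot>\<^bsub>W\<^esub> w"
      by (auto dest!: sur simp: smult add smult_r_distr)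
  qed
  then show ?thesis
    using vectorspace_axioms mem
    by (auto simp: linear_map_def mod_hom_def mod_hom_axioms_def module_hom_def vectorspace_def
        add smult)
qed

text \<open>Gives access to the coset lemmas, which are stated for abelian subgroups. Closure under
  negation is closure under the scalar -1.\<close>

lemma (in vectorspace) abelian_subgroup_subspace:
  assumes "subspace K N V"
  shows "abelian_subgroup N V"
proof (rule abelian_subgroupI3)
  have s: "submodule K N V" using assms by (simp add: subspace_def)
  have "\<ominus>\<^bsub>V\<^esub> v \<in> N" if "v \<in> N" for v
  proof -
    have "\<ominus>\<^bsub>V\<^esub> v = (\<ominus>\<^bsub>K\<^esub> \<one>\<^bsub>K\<^esub>) \<odot>\<^bsub>V\<^esub> v"
      using that subspace_subset_carrier[OF assms] by (subst smult_minus_1) auto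
    then show ?thesis using that s by (auto simp: submodule_def)
  qed
  then show "additive_subgroup N V"
    using s by (auto simp: submodule_def additive_subgroup_def a_inv_def intro!: subgroup.intro)
  show "abelian_group V" ..
qed

lemma quotient_linear_map:
  fixes V :: "('k, 'b) module"
  assumes "subspace K N V"
  shows "linear_map K V (quotient_space V N) (\<lambda>v. N +>\<^bsub>V\<^esub> v)"
proof -
  interpret V: vectorspace K V using assms by (simp add: subspace_def)
  interpret N: abelian_subgroup N V using assms by (rule V.abelian_subgroup_subspace)
  have N: "N \<subseteq> carrier V" using assms by (rule V.subspace_subset_carrier)
  show ?thesis
  proof (rule V.vectorspace_surjective_image)
    show "(\<lambda>v. N +>\<^bsub>V\<^esub> v) ` carrier V = carrier (quotient_space V N)"
      by (auto simp: quotient_space_def A_RCOSETS_def')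
    show "N +>\<^bsub>V\<^esub> \<zero>\<^bsub>V\<^esub> = \<zero>\<^bsub>quotient_space V N\<^esub>"
      using N by (simp add: quotient_space_def)
    show "(N +>\<^bsub>V\<^esub> v) \<oplus>\<^bsub>quotient_space V N\<^esub> (N +>\<^bsub>V\<^esub> w) = N +>\<^bsub>V\<^esub> (v \<oplus>\<^bsub>V\<^esub> w)"
      if "v \<in> carrier V" "w \<in> carrier V" for v w
      using that by (simp add: quotient_space_def N.a_rcos_sum)
    fix c v assume c: "c \<in> carrier K" and v: "v \<in> carrier V"
    \<comment> \<open>All representatives of one coset give the same coset after scaling, so the
      union that defines \<open>smult\<close> collapses to a single coset.\<close>
    have "N +>\<^bsub>V\<^esub> (c \<odot>\<^bsub>V\<^esub> u) = N +>\<^bsub>V\<^esub> (c \<odot>\<^bsub>V\<^esub> v)" if u: "u \<in> N +>\<^bsub>V\<^esub> v" for u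
    proof -
      obtain w where w: "w \<in> N" "u = w \<oplus>\<^bsub>V\<^esub> v"
        using u by (auto simp: a_r_coset_def')
      then have "c \<odot>\<^bsub>V\<^esub> u = c \<odot>\<^bsub>V\<^esub> w \<oplus>\<^bsub>V\<^esub> c \<odot>\<^bsub>V\<^esub> v"
        using c v N by (auto simp: V.smult_r_distr)
      moreover have "c \<odot>\<^bsub>V\<^esub> w \<in> N" using w c assms by (simp add: subspace_def submodule_def)
      ultimately have "c \<odot>\<^bsub>V\<^esub> u \<in> N +>\<^bsub>V\<^esub> (c \<odot>\<^bsub>V\<^esub> v)"
        by (auto simp: a_r_coset_def')
      then show ?thesis using c v by (metis N.a_repr_independence' V.smult_closed)
    qed
    moreover have "v \<in> N +>\<^bsub>V\<^esub> v" using v by (rule N.a_rcos_self)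
    ultimately have "(\<Union>u\<in>N +>\<^bsub>V\<^esub> v. N +>\<^bsub>V\<^esub> (c \<odot>\<^bsub>V\<^esub> u)) = N +>\<^bsub>V\<^esub> (c \<odot>\<^bsub>V\<^esub> v)"
      by blast
    then show "c \<odot>\<^bsub>quotient_space V N\<^esub> (N +>\<^bsub>V\<^esub> v) = N +>\<^bsub>V\<^esub> (c \<odot>\<^bsub>V\<^esub> v)"
      by (simp add: quotient_space_def)
  qed
qed

lemma quotient_space_surj:
  "(\<lambda>v. N +>\<^bsub>V\<^esub> v) ` carrier V = carrier (quotient_space V N)"
  by (auto simp: quotient_space_def A_RCOSETS_def')

lemma quotient_space_zero_iff:
  assumes "subspace K N V" and "v \<in> carrier V"
  shows "N +>\<^bsub>V\<^esub> v = \<zero>\<^bsub>quotient_space V N\<^esub> \<longleftrightarrow> v \<in> N"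
proof -
  interpret V: vectorspace K V using assms by (simp add: subspace_def)
  interpret N: abelian_subgroup N V using assms(1) by (rule V.abelian_subgroup_subspace)
  show ?thesis
    using N.a_rcos_self[OF assms(2)] N.a_rcos_const
    by (auto simp: quotient_space_def)
qed

lemma dim_quotient_image:
  fixes V :: "('k, 'b) module"
  assumes "subspace K N V" and "subspace K C V" and "N \<subseteq> C" and "vectorspace.fin_dim K V"
  shows "vectorspace.dim K (V\<lparr>carrier := C\<rparr>) =
    vectorspace.dim K ((quotient_space V N)\<lparr>carrier := (\<lambda>v. N +>\<^bsub>V\<^esub> v) ` C\<rparr>) +
    vectorspace.dim K (V\<lparr>carrier := N\<rparr>)"
proof -
  interpret linear_map K V "quotient_space V N" "\<lambda>v. N +>\<^bsub>V\<^esub> v"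
    using assms(1) by (rule quotient_linear_map)
  have "{v \<in> C. N +>\<^bsub>V\<^esub> v = \<zero>\<^bsub>quotient_space V N\<^esub>} = N"
    using quotient_space_zero_iff[OF assms(1)] V.subspace_subset_carrier[OF assms(2)] assms(3)
    by blast
  then show ?thesis using dim_image[OF assms(2,4)] by simp
qed

section \<open>Sums of subspaces and the modular law for dimensions\<close>

lemma subspace_set_add:
  assumes "subspace K A V" and "subspace K B V"
  shows "subspace K (A <+>\<^bsub>V\<^esub> B) V" "A \<subseteq> A <+>\<^bsub>V\<^esub> B" "B \<subseteq> A <+>\<^bsub>V\<^esub> B"
proof -
  interpret V: vectorspace K V using assms by (simp add: subspace_def)
  have A: "A \<subseteq> carrier V" and B: "B \<subseteq> carrier V"
    using assms by (simp_all add: V.subspace_subset_carrier)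
  have "A <+>\<^bsub>V\<^esub> B = V.submodule_sum A B"
    by (auto simp: set_add_def' V.submodule_sum_def)
  then show "subspace K (A <+>\<^bsub>V\<^esub> B) V"
    using V.sum_is_subspace[OF assms] by simp
  have "a \<in> A <+>\<^bsub>V\<^esub> B" if "a \<in> A" for a
    using V.zero_in_subspace[OF assms(2)] that A V.r_zero[of a]
    unfolding set_add_def' by blast
  then show "A \<subseteq> A <+>\<^bsub>V\<^esub> B" by blast
  have "b \<in> A <+>\<^bsub>V\<^esub> B" if "b \<in> B" for b
    using V.zero_in_subspace[OF assms(1)] that B V.l_zero[of b]
    unfolding set_add_def' by blast
  then show "B \<subseteq> A <+>\<^bsub>V\<^esub> B" by blast
qed

lemma set_add_subset:
  assumes "subspace K C V" "A \<subseteq> C" "B \<subseteq> C"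
  shows "A <+>\<^bsub>V\<^esub> B \<subseteq> C"
proof -
  have "submodule K C V" using assms(1) by (simp add: subspace_def)
  then show ?thesis
    using assms(2,3) submodule.m_closed by (fastforce simp: set_add_def')
qed

text \<open>The second isomorphism theorem in numbers: A and A + B have the same image in V/B, and
  the projection has kernel A \<inter> B on the one and B on the other.\<close>

lemma dim_sum_int:
  fixes V :: "('k, 'b) module"
  assumes "subspace K A V" and "subspace K B V" and "vectorspace.fin_dim K V"
  shows "vectorspace.dim K (V\<lparr>carrier := A <+>\<^bsub>V\<^esub> B\<rparr>) + vectorspace.dim K (V\<lparr>carrier := A \<inter> B\<rparr>) =
    vectorspace.dim K (V\<lparr>carrier := A\<rparr>) + vectorspace.dim K (V\<lparr>carrier := B\<rparr>)"
proof -
  interpret linear_map K V "quotient_space V B" "\<lambda>v. B +>\<^bsub>V\<^esub> v"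
    using assms(2) by (rule quotient_linear_map)
  interpret B: abelian_subgroup B V using assms(2) by (rule V.abelian_subgroup_subspace)
  have A: "A \<subseteq> carrier V" and B: "B \<subseteq> carrier V"
    using assms by (simp_all add: V.subspace_subset_carrier)
  note sum = subspace_set_add[OF assms(1,2)]
  have *: "B +>\<^bsub>V\<^esub> (a \<oplus>\<^bsub>V\<^esub> b) = B +>\<^bsub>V\<^esub> a" if "a \<in> A" "b \<in> B" for a b
  proof -
    have "a \<in> carrier V" "b \<in> carrier V" using that A B by auto
    then show ?thesis
      using quotient_space_zero_iff[OF assms(2), of b] that(2) W.module.M.r_zero f_add f_im by metis
  qed
  have "(\<lambda>v. B +>\<^bsub>V\<^esub> v) ` (A <+>\<^bsub>V\<^esub> B) = (\<lambda>v. B +>\<^bsub>V\<^esub> v) ` A"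
    using sum(2) by (auto simp: set_add_def' *)
  moreover have "{v \<in> A. B +>\<^bsub>V\<^esub> v = \<zero>\<^bsub>quotient_space V B\<^esub>} = A \<inter> B"
    using quotient_space_zero_iff[OF assms(2)] A by blast
  ultimately show ?thesis
    using dim_image[OF assms(1,3)] dim_quotient_image[OF assms(2) sum(1,3) assms(3)] by simp
qed

section \<open>Harder-Narasimhan chains in lattices with a rank and a degree\<close>

text \<open>The order is only a preorder: subrepresentations are functions on a whole type, and two
  that agree on \<open>verts Q\<close> are the same object without being equal. Hence uniqueness is
  up to \<open>\<approx>\<close>. The modular law is imposed only on the numbers \<open>r\<close>
  and \<open>d\<close>. Finiteness of the degrees stands in for finiteness of the lattice, which
  fails over infinite fields.\<close>

locale ranked_lattice =
  fixes L :: "'a set"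
    and le :: "'a \<Rightarrow> 'a \<Rightarrow> bool" (infix "\<sqsubseteq>" 50)
    and meet join :: "'a \<Rightarrow> 'a \<Rightarrow> 'a"
    and bot top :: 'a
    and r :: "'a \<Rightarrow> nat"
    and d :: "'a \<Rightarrow> real"
  assumes le_refl: "A \<sqsubseteq> A"
    and le_trans: "A \<sqsubseteq> B \<Longrightarrow> B \<sqsubseteq> C \<Longrightarrow> A \<sqsubseteq> C"
    and meet_in: "A \<in> L \<Longrightarrow> B \<in> L \<Longrightarrow> meet A B \<in> L"
    and meet_le1: "meet A B \<sqsubseteq> A"
    and meet_le2: "meet A B \<sqsubseteq> B"
    and le_meet: "C \<sqsubseteq> A \<Longrightarrow> C \<sqsubseteq> B \<Longrightarrow> C \<sqsubseteq> meet A B"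
    and join_in: "A \<in> L \<Longrightarrow> B \<in> L \<Longrightarrow> join A B \<in> L"
    and le_join1: "A \<in> L \<Longrightarrow> B \<in> L \<Longrightarrow> A \<sqsubseteq> join A B"
    and le_join2: "A \<in> L \<Longrightarrow> B \<in> L \<Longrightarrow> B \<sqsubseteq> join A B"
    and join_le: "A \<in> L \<Longrightarrow> B \<in> L \<Longrightarrow> C \<in> L \<Longrightarrow> A \<sqsubseteq> C \<Longrightarrow> B \<sqsubseteq> C \<Longrightarrow> join A B \<sqsubseteq> C"
    and bot_in: "bot \<in> L" and bot_le: "A \<in> L \<Longrightarrow> bot \<sqsubseteq> A"
    and top_in: "top \<in> L" and le_top: "A \<in> L \<Longrightarrow> A \<sqsubseteq> top"
    and r_mono: "A \<in> L \<Longrightarrow> B \<in> L \<Longrightarrow> A \<sqsubseteq> B \<Longrightarrow> r A \<le> r B"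
    and r_eq: "A \<in> L \<Longrightarrow> B \<in> L \<Longrightarrow> A \<sqsubseteq> B \<Longrightarrow> r A = r B \<Longrightarrow> B \<sqsubseteq> A"
    and d_cong: "A \<in> L \<Longrightarrow> B \<in> L \<Longrightarrow> A \<sqsubseteq> B \<Longrightarrow> B \<sqsubseteq> A \<Longrightarrow> d A = d B"
    and r_modular: "A \<in> L \<Longrightarrow> B \<in> L \<Longrightarrow> r (join A B) + r (meet A B) = r A + r B"
    and d_modular: "A \<in> L \<Longrightarrow> B \<in> L \<Longrightarrow> d (join A B) + d (meet A B) = d A + d B"
    and finite_d: "finite (d ` L)"
begin

definition le_equiv (infix "\<approx>" 50) where "A \<approx> B \<longleftrightarrow> A \<sqsubseteq> B \<and> B \<sqsubseteq> A"

text \<open>The slope of the subquotient B/A, read off from its two ends.\<close>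

definition incline :: "'a \<Rightarrow> 'a \<Rightarrow> real" where
  "incline A B = (d B - d A) / (real (r B) - real (r A))"

text \<open>Semistability of B/A, whose subobjects correspond to the C between A and B; the strict
  rank inequalities say that B/A and C/A are nonzero.\<close>

definition stable :: "'a \<Rightarrow> 'a \<Rightarrow> bool" where
  "stable A B \<longleftrightarrow> A \<sqsubseteq> B \<and> r A < r B \<and>
     (\<forall>C\<in>L. A \<sqsubseteq> C \<longrightarrow> C \<sqsubseteq> B \<longrightarrow> r A < r C \<longrightarrow> incline A C \<le> incline A B)"

text \<open>The start \<open>F 0\<close> is left free so that existence can be proved by induction
  on the rank remaining above it; \<open>F 0 \<approx> bot\<close> is added where it is
  wanted.\<close>

definition hn_chain :: "nat \<Rightarrow> (nat \<Rightarrow> 'a) \<Rightarrow> bool" where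
  "hn_chain n F \<longleftrightarrow> (\<forall>k\<le>n. F k \<in> L) \<and> F n \<approx> top \<and> (\<forall>k<n. stable (F k) (F (Suc k))) \<and>
     (\<forall>k. Suc k < n \<longrightarrow> incline (F (Suc k)) (F (Suc (Suc k))) < incline (F k) (F (Suc k)))"

definition potential :: "real \<Rightarrow> 'a \<Rightarrow> real" where
  "potential t A = d A - t * real (r A)"

definition least_maximizer :: "real \<Rightarrow> 'a \<Rightarrow> bool" where
  "least_maximizer t X \<longleftrightarrow> X \<in> L \<and>
     (\<forall>A\<in>L. potential t A \<le> potential t X \<and> (potential t A = potential t X \<longrightarrow> X \<sqsubseteq> A))"

lemma r_cong: "A \<in> L \<Longrightarrow> B \<in> L \<Longrightarrow> A \<approx> B \<Longrightarrow> r A = r B"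
  by (simp add: le_equiv_def r_mono order_antisym)

lemma potential_cong: "A \<in> L \<Longrightarrow> B \<in> L \<Longrightarrow> A \<approx> B \<Longrightarrow> potential t A = potential t B"
  using r_cong[of A B] d_cong[of A B] by (simp add: potential_def le_equiv_def)

lemma potential_modular:
  assumes "A \<in> L" "B \<in> L"
  shows "potential t (join A B) + potential t (meet A B) = potential t A + potential t B"
proof -
  have "real (r (join A B)) + real (r (meet A B)) = real (r A) + real (r B)"
    using r_modular[OF assms] by (metis of_nat_add)
  then have "t * real (r (join A B)) + t * real (r (meet A B)) = t * real (r A) + t * real (r B)"
    by (metis distrib_left)
  then show ?thesis using d_modular[OF assms] by (simp add: potential_def)
qed

text \<open>The gain of \<open>potential t\<close> across B/A has the sign of the slope minus
  \<open>t\<close>. This turns comparisons of ratios into comparisons of quantities that add up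
  along a chain.\<close>

lemma potential_diff:
  assumes "r A < r B"
  shows "potential t B - potential t A = (incline A B - t) * (real (r B) - real (r A))"
  using assms by (simp add: potential_def incline_def field_simps)

lemma least_maximizer_unique: "least_maximizer t X \<Longrightarrow> least_maximizer t Y \<Longrightarrow> X \<approx> Y"
  unfolding least_maximizer_def le_equiv_def by (meson order_antisym)

lemma finite_r: "finite (r ` L)"
proof (rule finite_subset)
  show "r ` L \<subseteq> {..r top}" using r_mono le_top top_in by auto
qed simp

text \<open>The first step goes to an object of maximal slope over \<open>A\<close> and, among
  those, of maximal rank; the induction hypothesis continues from there. Maximality of the slope
  makes the step stable, maximality of the rank makes the next slope strictly smaller.\<close>

lemma exists_hn_chain_from:
  assumes "A \<in> L"
  shows "\<exists>n F. hn_chain n F \<and> F 0 = A"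
  using assms
proof (induction "r top - r A" arbitrary: A rule: less_induct)
  case less
  show ?case
  proof (cases "r A = r top")
    case True
    then have "hn_chain 0 (\<lambda>_. A)"
      using less.prems le_top top_in r_eq[of A top] by (simp add: hn_chain_def le_equiv_def)
    then show ?thesis by blast
  next
    case False
    then have "r A < r top"
      using r_mono[OF less.prems top_in le_top[OF less.prems]] by simp
    define S where "S = {C \<in> L. A \<sqsubseteq> C \<and> r A < r C}"
    have "top \<in> S" using \<open>r A < r top\<close> less.prems by (simp add: S_def top_in le_top)
    \<comment> \<open>\<open>S\<close> may be infinite, but an incline over \<open>A\<close> depends
      only on a degree and a rank, and each of these takes finitely many values.\<close>
    have "incline A ` S \<subseteq> (\<lambda>(u, v). (u - d A) / (real v - real (r A))) ` (d ` L \<times> r ` L)"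
      by (force simp: incline_def S_def)
    then have fin: "finite (incline A ` S)"
      using finite_d finite_r by (meson finite_SigmaI finite_imageI finite_subset)
    define \<mu> where "\<mu> = Max (incline A ` S)"
    define S' where "S' = {C \<in> S. incline A C = \<mu>}"
    have le: "incline A C \<le> \<mu>" if "C \<in> S" for C using fin that by (simp add: \<mu>_def)
    have "\<mu> \<in> incline A ` S" using fin \<open>top \<in> S\<close> unfolding \<mu>_def by (intro Max_in) auto
    then have "r ` S' \<noteq> {}" by (auto simp: S'_def)
    moreover have fin': "finite (r ` S')"
      using finite_r by (rule finite_subset[rotated]) (auto simp: S'_def S_def)
    ultimately have "Max (r ` S') \<in> r ` S'" by (rule Max_in[rotated])
    then obtain B where B: "B \<in> S'" "r B = Max (r ` S')" by auto
    then have BL: "B \<in> L" "A \<sqsubseteq> B" "r A < r B" and slB: "incline A B = \<mu>" by (auto simp: S'_def S_def)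
    have max: "r C \<le> r B" if "C \<in> S'" for C using B(2) fin' that by simp
    have "stable A B" using BL le slB by (auto simp: stable_def S_def)
    have "r B \<le> r top" using BL by (simp add: r_mono top_in le_top)
    then have "r top - r B < r top - r A" using BL by simp
    then obtain n F where F: "hn_chain n F" "F 0 = B" using less.hyps BL by blast
    \<comment> \<open>If the next step were at least as steep, \<open>potential \<mu>\<close> would
      not drop from \<open>A\<close> to \<open>F 1\<close>. Then \<open>F 1\<close> would also have
      the maximal slope over \<open>A\<close>, with rank above the maximum
      \<open>r B\<close>.\<close>
    have slope: "incline B (F 1) < \<mu>" if "0 < n"
    proof (rule ccontr)
      assume steep: "\<not> incline B (F 1) < \<mu>"
      have "stable B (F 1)" using F that by (auto simp: hn_chain_def)
      moreover have F1: "F 1 \<in> L" using F that by (auto simp: hn_chain_def)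
      ultimately have r: "B \<sqsubseteq> F 1" "r B < r (F 1)" by (auto simp: stable_def)
      then have S: "F 1 \<in> S" using F1 BL le_trans by (auto simp: S_def)
      have "0 \<le> (incline B (F 1) - \<mu>) * (real (r (F 1)) - real (r B))"
        using steep r by simp
      then have "0 \<le> potential \<mu> (F 1) - potential \<mu> B" using potential_diff[OF r(2)] by simp
      moreover have "potential \<mu> B - potential \<mu> A = 0" using potential_diff[OF BL(3)] slB by simp
      moreover have rA: "r A < r (F 1)" using r BL by simp
      ultimately have "0 \<le> (incline A (F 1) - \<mu>) * (real (r (F 1)) - real (r A))"
        using potential_diff[OF rA, of \<mu>] by simp
      then have "\<mu> \<le> incline A (F 1)" using rA by (simp add: zero_le_mult_iff)
      then have "F 1 \<in> S'" using S le[OF S] by (simp add: S'_def)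
      then show False using max r by fastforce
    qed
    define G where "G k = (case k of 0 \<Rightarrow> A | Suc k \<Rightarrow> F k)" for k
    have "hn_chain (Suc n) G"
      using F \<open>stable A B\<close> less.prems slope slB
      by (auto simp: hn_chain_def G_def split: nat.split)
    then show ?thesis by (auto simp: G_def intro!: exI[of _ "Suc n"] exI[of _ G])
  qed
qed

section \<open>Maximizers of the potential along a chain that starts at the bottom\<close>

context
  fixes n F
  assumes chain: "hn_chain n F" and start: "F 0 \<approx> bot"
begin

lemma chain_in: "k \<le> n \<Longrightarrow> F k \<in> L"
  and chain_stable: "k < n \<Longrightarrow> stable (F k) (F (Suc k))"
  and chain_top: "F n \<approx> top"
  using chain by (auto simp: hn_chain_def)

lemma chain_incline_antimono: "i < j \<Longrightarrow> j < n \<Longrightarrow> incline (F j) (F (Suc j)) < incline (F i) (F (Suc i))"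
proof (induction j)
  case (Suc j)
  have "incline (F (Suc j)) (F (Suc (Suc j))) < incline (F j) (F (Suc j))"
    using chain Suc.prems by (simp add: hn_chain_def)
  then show ?case using Suc by (cases "i = j") auto
qed simp

lemma chain_rank_mono: "i < j \<Longrightarrow> j \<le> n \<Longrightarrow> r (F i) < r (F j)"
proof (induction j)
  case (Suc j)
  have "r (F j) < r (F (Suc j))" using chain_stable Suc.prems by (simp add: stable_def)
  then show ?case using Suc by (cases "i = j") auto
qed simp

lemma chain_le:
  assumes "i \<le> j" "j \<le> n"
  shows "F i \<sqsubseteq> F j"
  using assms
proof (induction j rule: dec_induct)
  case (step j)
  then have "F j \<sqsubseteq> F (Suc j)" using chain_stable by (simp add: stable_def)
  then show ?case using step le_trans[of "F i" "F j"] by simp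
qed (rule le_refl)

text \<open>\<open>C\<close> plays the image of \<open>meet A (F (Suc i))\<close> in the quotient of
  \<open>F (Suc i)\<close> by \<open>F i\<close>. By modularity, \<open>C\<close> over
  \<open>F i\<close> has the same rank and potential as the i-th graded piece of \<open>A\<close>;
  unlike that piece it lies between the ends of a stable step, so stability applies to it.\<close>

lemma chain_step:
  assumes A: "A \<in> L" and i: "i < n"
  defines "C \<equiv> join (meet A (F (Suc i))) (F i)"
  shows "C \<in> L" "F i \<sqsubseteq> C" "C \<sqsubseteq> F (Suc i)"
    "potential t C - potential t (F i) =
      potential t (meet A (F (Suc i))) - potential t (meet A (F i))"
    "r C + r (meet A (F i)) = r (meet A (F (Suc i))) + r (F i)"
proof -
  have F: "F i \<in> L" "F (Suc i) \<in> L" "F i \<sqsubseteq> F (Suc i)"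
    using i chain_in chain_stable[OF i] by (auto simp: stable_def)
  let ?B = "meet A (F (Suc i))"
  have B: "?B \<in> L" using A F by (simp add: meet_in)
  show "C \<in> L" "F i \<sqsubseteq> C" "C \<sqsubseteq> F (Suc i)"
    using F B by (auto simp: C_def join_in le_join2 meet_le2 join_le)
  have "meet ?B (F i) \<approx> meet A (F i)"
    unfolding le_equiv_def by (meson F(3) le_meet le_trans meet_le1 meet_le2)
  moreover have "meet ?B (F i) \<in> L" "meet A (F i) \<in> L" using A B F by (auto simp: meet_in)
  ultimately have "potential t (meet ?B (F i)) = potential t (meet A (F i))"
      and "r (meet ?B (F i)) = r (meet A (F i))"
    by (simp_all add: potential_cong r_cong)
  then show "potential t C - potential t (F i) = potential t ?B - potential t (meet A (F i))"
      and "r C + r (meet A (F i)) = r ?B + r (F i)"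
    using potential_modular[OF B F(1), of t] r_modular[OF B F(1)] by (simp_all add: C_def)
qed

text \<open>Stability bounds the gain of \<open>C\<close> over \<open>F i\<close> by (\<mu> - t)
  times its rank increase. As \<mu> > t, this is at most the gain of the full step, with equality
  only if \<open>C\<close> has the rank of \<open>F (Suc i)\<close>. The equality case is what later
  yields leastness among the maximizers.\<close>

lemma chain_step_below:
  assumes "A \<in> L" "i < n" "t < incline (F i) (F (Suc i))"
  shows "potential t (meet A (F (Suc i))) - potential t (meet A (F i)) \<le>
      potential t (F (Suc i)) - potential t (F i)"
    and "potential t (meet A (F (Suc i))) - potential t (meet A (F i)) =
      potential t (F (Suc i)) - potential t (F i) \<Longrightarrow>
      r (meet A (F (Suc i))) + r (F i) = r (F (Suc i)) + r (meet A (F i))"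
proof -
  define C where "C = join (meet A (F (Suc i))) (F i)"
  note C = chain_step[OF assms(1,2), folded C_def]
  have st: "stable (F i) (F (Suc i))" using chain_stable assms(2) .
  then have rF: "r (F i) < r (F (Suc i))" by (simp add: stable_def)
  have F: "F i \<in> L" "F (Suc i) \<in> L" using assms(2) chain_in by auto
  let ?\<mu> = "incline (F i) (F (Suc i))"
  have rC: "r (F i) \<le> r C" "r C \<le> r (F (Suc i))" using C F r_mono by auto
  \<comment> \<open>Stability speaks only of objects of larger rank than \<open>F i\<close>; in the
    remaining case \<open>C\<close> is equivalent to \<open>F i\<close> and both sides
    vanish.\<close>
  have "potential t C - potential t (F i) \<le> (?\<mu> - t) * (real (r C) - real (r (F i)))"
  proof (cases "r (F i) < r C")
    case True
    then have "incline (F i) C \<le> ?\<mu>" using st C unfolding stable_def by blast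
    then show ?thesis using True by (simp add: potential_diff mult_right_mono)
  next
    case False
    then have "F i \<approx> C" using C(2) r_eq[OF F(1) C(1,2)] rC by (simp add: le_equiv_def)
    then show ?thesis using False rC potential_cong[OF F(1) C(1)] by simp
  qed
  moreover have "(?\<mu> - t) * (real (r C) - real (r (F i))) + (?\<mu> - t) * (real (r (F (Suc i))) - real (r C)) =
      potential t (F (Suc i)) - potential t (F i)"
    by (simp add: potential_diff[OF rF] algebra_simps)
  moreover have "0 \<le> (?\<mu> - t) * (real (r (F (Suc i))) - real (r C))"
    using assms(3) rC by simp
  ultimately have le: "potential t C - potential t (F i) \<le> potential t (F (Suc i)) - potential t (F i)"
    and eq: "potential t C - potential t (F i) = potential t (F (Suc i)) - potential t (F i) \<Longrightarrow>
      (?\<mu> - t) * (real (r (F (Suc i))) - real (r C)) = 0"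
    by linarith+
  show "potential t (meet A (F (Suc i))) - potential t (meet A (F i)) \<le>
      potential t (F (Suc i)) - potential t (F i)"
    using le C(4)[of t] by linarith
  assume "potential t (meet A (F (Suc i))) - potential t (meet A (F i)) =
      potential t (F (Suc i)) - potential t (F i)"
  then have "r C = r (F (Suc i))" using eq C(4)[of t] assms(3) by simp
  then show "r (meet A (F (Suc i))) + r (F i) = r (F (Suc i)) + r (meet A (F i))"
    using C(5) by linarith
qed

text \<open>The gain equals that of \<open>C\<close> over \<open>F i\<close>, whose slope is at most
  that of the step and hence at most \<open>t\<close>.\<close>

lemma chain_step_above:
  assumes "A \<in> L" "i < n" "incline (F i) (F (Suc i)) \<le> t"
  shows "potential t (meet A (F (Suc i))) \<le> potential t (meet A (F i))"
proof -
  define C where "C = join (meet A (F (Suc i))) (F i)"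
  note C = chain_step[OF assms(1,2), folded C_def]
  have st: "stable (F i) (F (Suc i))" using chain_stable assms(2) .
  have F: "F i \<in> L" "F (Suc i) \<in> L" using assms(2) chain_in by auto
  have rC: "r (F i) \<le> r C" using C F r_mono by auto
  have "potential t C - potential t (F i) \<le> 0"
  proof (cases "r (F i) < r C")
    case True
    then have "incline (F i) C \<le> t" using st C assms(3) unfolding stable_def by force
    then show ?thesis using True by (simp add: potential_diff mult_nonpos_nonneg)
  next
    case False
    then have "F i \<approx> C" using C(2) r_eq[OF F(1) C(1,2)] rC by (simp add: le_equiv_def)
    then show ?thesis using potential_cong[OF F(1) C(1)] by simp
  qed
  then show ?thesis using C(4)[of t] by linarith
qed

text \<open>Summing the gains of \<open>potential t\<close> along \<open>meet A (F i)\<close>: a step of incline above \<open>t\<close>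
  gains at most what the chain itself gains, and a step of incline at most \<open>t\<close> gains nothing.\<close>

lemma chain_least_maximizer:
  assumes k: "k \<le> n"
    and below: "\<And>i. i < k \<Longrightarrow> t < incline (F i) (F (Suc i))"
    and above: "\<And>i. k \<le> i \<Longrightarrow> i < n \<Longrightarrow> incline (F i) (F (Suc i)) \<le> t"
  shows "least_maximizer t (F k)"
proof -
  have "potential t A \<le> potential t (F k) \<and> (potential t A = potential t (F k) \<longrightarrow> F k \<sqsubseteq> A)"
    if A: "A \<in> L" for A
  proof -
    let ?a = "\<lambda>i. meet A (F i)"
    have aL: "?a i \<in> L" if "i \<le> n" for i using that A chain_in meet_in by simp
    have lower: "potential t (?a j) \<le> potential t (F j) \<and>
        (potential t (?a j) = potential t (F j) \<longrightarrow> F j \<sqsubseteq> A)" if "j \<le> k" for j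
      using that
    proof (induction j)
      case 0
      have "F 0 \<sqsubseteq> A" using start bot_le[OF A] le_trans by (auto simp: le_equiv_def)
      moreover from this have "?a 0 \<approx> F 0" by (simp add: le_equiv_def meet_le2 le_meet le_refl)
      ultimately show ?case using potential_cong[of "?a 0" "F 0"] aL chain_in by simp
    next
      case (Suc j)
      then have j: "j < n" "t < incline (F j) (F (Suc j))" using k below by auto
      note step = chain_step_below[OF A j]
      have IH: "potential t (?a j) \<le> potential t (F j)"
        "potential t (?a j) = potential t (F j) \<Longrightarrow> F j \<sqsubseteq> A" using Suc by auto
      \<comment> \<open>Neither of the two gains making up an equality at \<open>Suc j\<close> can
        have slack. So equality already held at \<open>j\<close>, where
        \<open>F j \<sqsubseteq> A\<close> makes \<open>meet A (F j)\<close> of full rank, and the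
        equality case of the step carries full rank on to \<open>Suc j\<close>.\<close>
      have "F (Suc j) \<sqsubseteq> A" if eq: "potential t (?a (Suc j)) = potential t (F (Suc j))"
      proof -
        have e: "potential t (?a j) = potential t (F j)" using eq step(1) IH(1) by linarith
        then have "F j \<sqsubseteq> A" using IH(2) by simp
        then have "?a j \<approx> F j" by (simp add: le_equiv_def meet_le2 le_meet le_refl)
        then have "r (?a j) = r (F j)" using r_cong[of "?a j" "F j"] aL chain_in j by simp
        then have "r (?a (Suc j)) = r (F (Suc j))" using step(2) eq e by simp
        then have "F (Suc j) \<sqsubseteq> ?a (Suc j)"
          using r_eq[OF aL chain_in meet_le2] j by simp
        then show ?thesis using le_trans meet_le1 by blast
      qed
      then show ?case using step(1) IH(1) by fastforce
    qed
    have upper: "potential t (?a (k + j)) \<le> potential t (?a k)" if "k + j \<le> n" for j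
      using that
    proof (induction j)
      case (Suc j)
      then show ?case using chain_step_above[OF A, of "k + j" t] above[of "k + j"] by simp
    qed simp
    have "A \<sqsubseteq> F n" using chain_top le_top[OF A] le_trans by (auto simp: le_equiv_def)
    then have "?a n \<approx> A" by (simp add: le_equiv_def meet_le1 le_meet le_refl)
    then have "potential t A = potential t (?a n)" using potential_cong[of "?a n" A] aL A by simp
    then show ?thesis using upper[of "n - k"] lower[of k] k by fastforce
  qed
  then show ?thesis using k chain_in by (simp add: least_maximizer_def)
qed

lemma exists_chain_least_maximizer: "\<exists>k\<le>n. least_maximizer t (F k)"
proof -
  \<comment> \<open>The first step of incline at most \<open>t\<close>; the implication makes
    \<open>k = n\<close> if there is none.\<close>
  define k where "k = (LEAST k. k < n \<longrightarrow> incline (F k) (F (Suc k)) \<le> t)"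
  have "k < n \<longrightarrow> incline (F k) (F (Suc k)) \<le> t"
    unfolding k_def by (rule LeastI[of _ n]) simp
  moreover have "k \<le> n" unfolding k_def by (rule Least_le) simp
  moreover have "t < incline (F i) (F (Suc i))" if "i < k" for i
    using not_less_Least[OF that[unfolded k_def]] by auto
  moreover have "incline (F i) (F (Suc i)) \<le> t" if "k \<le> i" "i < n" for i
    using chain_incline_antimono[of k i] that calculation(1) by (cases "k = i") fastforce+
  ultimately have "least_maximizer t (F k)" by (intro chain_least_maximizer) auto
  then show ?thesis using \<open>k \<le> n\<close> by blast
qed

text \<open>For \<open>k < n\<close> take as \<open>t\<close> the incline of the step leaving
  \<open>F k\<close>: earlier steps are strictly steeper, and a tie at \<open>k\<close> itself is
  permitted. For \<open>k = n\<close> any \<open>t\<close> below the last incline serves, and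
  subtracting 1 gives one; for \<open>n = 0\<close> any \<open>t\<close> does.\<close>

lemma chain_is_least_maximizer:
  assumes "k \<le> n"
  shows "\<exists>t. least_maximizer t (F k)"
proof (cases "k = n")
  case False
  then show ?thesis
    using assms chain_incline_antimono
    by (intro exI[of _ "incline (F k) (F (Suc k))"] chain_least_maximizer)
      (auto simp: le_less)
next
  case True
  show ?thesis
  proof (cases n)
    case (Suc m)
    have "incline (F m) (F (Suc m)) \<le> incline (F i) (F (Suc i))" if "i < n" for i
      using that chain_incline_antimono[of i m] Suc by (cases "i = m") auto
    then show ?thesis
      using True by (intro exI[of _ "incline (F m) (F (Suc m)) - 1"] chain_least_maximizer) force+
  qed (use True in \<open>auto intro!: exI[of _ 0] chain_least_maximizer\<close>)
qed

end

text \<open>\<open>F k\<close> is the least maximizer for some \<open>t\<close>. The other chain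
  also contains a least maximizer for that \<open>t\<close>, and least maximizers are unique up to
  equivalence.\<close>

lemma hn_chain_members:
  assumes "hn_chain n F" "F 0 \<approx> bot" "hn_chain m G" "G 0 \<approx> bot" and "k \<le> n"
  shows "\<exists>j\<le>m. F k \<approx> G j"
  using chain_is_least_maximizer[OF assms(1,2,5)] exists_chain_least_maximizer[OF assms(3,4)]
    least_maximizer_unique by blast

text \<open>Members match, but a priori at different positions. Ranks increase strictly along both
  chains and agree on matching members: if \<open>F (Suc k)\<close> matched a later member than
  \<open>G (Suc k)\<close>, then \<open>G (Suc k)\<close> would match a member of \<open>F\<close>
  of rank strictly between those of \<open>F k\<close> and \<open>F (Suc k)\<close>.\<close>

lemma hn_chain_prefix:
  assumes F: "hn_chain n F" "F 0 \<approx> bot" and G: "hn_chain m G" "G 0 \<approx> bot"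
  shows "k \<le> n \<Longrightarrow> k \<le> m \<and> F k \<approx> G k"
proof (induction k)
  case 0
  then show ?case using F G le_trans by (auto simp: le_equiv_def)
next
  case (Suc k)
  have FL: "F i \<in> L" if "i \<le> n" for i using that F(1) by (simp add: hn_chain_def)
  have GL: "G i \<in> L" if "i \<le> m" for i using that G(1) by (simp add: hn_chain_def)
  have Frank: "r (F i) < r (F j) \<longleftrightarrow> i < j" if "i \<le> n" "j \<le> n" for i j
    using that chain_rank_mono[OF F] by (metis less_asym linorder_neqE_nat)
  have Grank: "r (G i) < r (G j) \<longleftrightarrow> i < j" if "i \<le> m" "j \<le> m" for i j
    using that chain_rank_mono[OF G] by (metis less_asym linorder_neqE_nat)
  have k: "k \<le> m" "F k \<approx> G k" using Suc by auto
  then have rk: "r (F k) = r (G k)" using r_cong[OF FL GL] Suc.prems by simp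
  obtain j where j: "j \<le> m" "F (Suc k) \<approx> G j" using hn_chain_members[OF F G Suc.prems] by blast
  then have rj: "r (F (Suc k)) = r (G j)" using r_cong[OF FL GL] Suc.prems by simp
  then have "k < j" using rk Frank[of k "Suc k"] Grank[of k j] j k Suc.prems by simp
  then have m: "Suc k \<le> m" using j by simp
  obtain i where i: "i \<le> n" "G (Suc k) \<approx> F i" using hn_chain_members[OF G F m] by blast
  then have ri: "r (G (Suc k)) = r (F i)" using r_cong[OF GL FL] m by simp
  then have "k < i" using rk Frank[of k i] Grank[of k "Suc k"] i k m Suc.prems by simp
  then have "\<not> r (F i) < r (F (Suc k))" using Frank[of i "Suc k"] i Suc.prems by simp
  then have "\<not> r (G (Suc k)) < r (G j)" using ri rj by simp
  then have "j = Suc k" using Grank[of "Suc k" j] \<open>k < j\<close> j m by simp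
  then show ?case using j by simp
qed

theorem hn_chain_unique:
  assumes "hn_chain n F" "F 0 \<approx> bot" "hn_chain m G" "G 0 \<approx> bot"
  shows "n = m" and "k \<le> n \<Longrightarrow> F k \<approx> G k"
  using hn_chain_prefix[OF assms] hn_chain_prefix[OF assms(3,4,1,2)] by (auto intro: order_antisym)

end

section \<open>The lattice of subrepresentations\<close>

locale charged_rep =
  fixes K :: "('k, 'm) ring_scheme"
    and Q :: "('v, 'e) pre_digraph"
    and V :: "('v, 'e, 'k, 'b) rep"
    and \<alpha> :: "'v \<Rightarrow> real"
  assumes fin_digraph: "fin_digraph Q"
    and quiver_rep: "quiver_rep K Q V"
begin

lemma finite_verts: "finite (verts Q)"
  using fin_digraph by (rule fin_digraph.finite_verts)

lemma tail_head_in_verts: "e \<in> arcs Q \<Longrightarrow> tail Q e \<in> verts Q \<and> head Q e \<in> verts Q"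
  using fin_digraph by (simp add: fin_digraph_def wf_digraph_def)

lemma vectorspace_at: "x \<in> verts Q \<Longrightarrow> vectorspace K (space_at V x)"
  and fin_dim_at: "x \<in> verts Q \<Longrightarrow> vectorspace.fin_dim K (space_at V x)"
  and linear_map_at: "e \<in> arcs Q \<Longrightarrow> linear_map K (space_at V (tail Q e)) (space_at V (head Q e)) (map_at V e)"
  using quiver_rep by (auto simp: quiver_rep_def)

abbreviation subreps :: "('v \<Rightarrow> 'b set) set" where
  "subreps \<equiv> {U. subrep K Q V U}"

definition le :: "('v \<Rightarrow> 'b set) \<Rightarrow> ('v \<Rightarrow> 'b set) \<Rightarrow> bool" where
  "le A B \<longleftrightarrow> (\<forall>x\<in>verts Q. A x \<subseteq> B x)"

definition sdim :: "('v \<Rightarrow> 'b set) \<Rightarrow> 'v \<Rightarrow> nat" where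
  "sdim A x = vectorspace.dim K ((space_at V x)\<lparr>carrier := A x\<rparr>)"

definition rank :: "('v \<Rightarrow> 'b set) \<Rightarrow> nat" where
  "rank A = (\<Sum>x\<in>verts Q. sdim A x)"

definition degree :: "('v \<Rightarrow> 'b set) \<Rightarrow> real" where
  "degree A = (\<Sum>x\<in>verts Q. \<alpha> x * real (sdim A x))"

lemma subrepD:
  assumes "subrep K Q V A"
  shows "x \<in> verts Q \<Longrightarrow> subspace K (A x) (space_at V x)"
    and "e \<in> arcs Q \<Longrightarrow> v \<in> A (tail Q e) \<Longrightarrow> map_at V e v \<in> A (head Q e)"
  using assms by (auto simp: subrep_def)

lemma subrep_inter:
  assumes "subrep K Q V A" "subrep K Q V B"
  shows "subrep K Q V (\<lambda>x. A x \<inter> B x)"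
  using assms subspace_inter by (fastforce simp: subrep_def)

lemma subrep_sum:
  assumes A: "subrep K Q V A" and B: "subrep K Q V B"
  shows "subrep K Q V (\<lambda>x. A x <+>\<^bsub>space_at V x\<^esub> B x)"
  unfolding subrep_def
proof (intro conjI ballI)
  show "subspace K (A x <+>\<^bsub>space_at V x\<^esub> B x) (space_at V x)" if "x \<in> verts Q" for x
    using subspace_set_add(1)[OF subrepD(1)[OF A that] subrepD(1)[OF B that]] .
next
  fix e assume e: "e \<in> arcs Q"
  then interpret linear_map K "space_at V (tail Q e)" "space_at V (head Q e)" "map_at V e"
    by (rule linear_map_at)
  have tv: "tail Q e \<in> verts Q" using e tail_head_in_verts by blast
  have "a \<in> carrier (space_at V (tail Q e))" if "a \<in> A (tail Q e) \<or> a \<in> B (tail Q e)" for a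
    using that V.subspace_subset_carrier subrepD(1)[OF A tv] subrepD(1)[OF B tv] by blast
  then show "map_at V e ` (A (tail Q e) <+>\<^bsub>space_at V (tail Q e)\<^esub> B (tail Q e)) \<subseteq>
      A (head Q e) <+>\<^bsub>space_at V (head Q e)\<^esub> B (head Q e)"
    using subrepD(2)[OF A e] subrepD(2)[OF B e] by (auto simp: set_add_def' f_add) blast
qed

lemma subrep_bot: "subrep K Q V (\<lambda>x. {\<zero>\<^bsub>space_at V x\<^esub>})"
  unfolding subrep_def
proof (intro conjI ballI)
  show "subspace K {\<zero>\<^bsub>space_at V x\<^esub>} (space_at V x)" if "x \<in> verts Q" for x
    using vectorspace.subspace_zero[OF vectorspace_at[OF that]] .
next
  fix e assume "e \<in> arcs Q"
  then interpret linear_map K "space_at V (tail Q e)" "space_at V (head Q e)" "map_at V e"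
    by (rule linear_map_at)
  show "map_at V e ` {\<zero>\<^bsub>space_at V (tail Q e)\<^esub>} \<subseteq> {\<zero>\<^bsub>space_at V (head Q e)\<^esub>}"
    by simp
qed

lemma subrep_top: "subrep K Q V (\<lambda>x. carrier (space_at V x))"
  unfolding subrep_def
proof (intro conjI ballI)
  show "subspace K (carrier (space_at V x)) (space_at V x)" if "x \<in> verts Q" for x
    using vectorspace.subspace_carrier[OF vectorspace_at[OF that]] .
next
  fix e assume "e \<in> arcs Q"
  then interpret linear_map K "space_at V (tail Q e)" "space_at V (head Q e)" "map_at V e"
    by (rule linear_map_at)
  show "map_at V e ` carrier (space_at V (tail Q e)) \<subseteq> carrier (space_at V (head Q e))"
    by auto
qed

lemma sdim_bot: "x \<in> verts Q \<Longrightarrow> A x = {\<zero>\<^bsub>space_at V x\<^esub>} \<Longrightarrow> sdim A x = 0"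
  by (simp add: sdim_def vectorspace.dim_zero_space vectorspace_at)

lemma sdim_mono:
  assumes "subrep K Q V A" "subrep K Q V B" "x \<in> verts Q" "A x \<subseteq> B x"
  shows "sdim A x \<le> sdim B x" and "sdim A x = sdim B x \<Longrightarrow> A x = B x"
  using vectorspace.subspace_dim_mono[OF vectorspace_at subrepD(1) subrepD(1) _ fin_dim_at] assms
  unfolding sdim_def by blast+

lemma sdim_modular:
  assumes "subrep K Q V A" "subrep K Q V B" "x \<in> verts Q"
  shows "sdim (\<lambda>x. A x <+>\<^bsub>space_at V x\<^esub> B x) x + sdim (\<lambda>x. A x \<inter> B x) x = sdim A x + sdim B x"
  unfolding sdim_def
  using dim_sum_int[OF subrepD(1)[OF assms(1,3)] subrepD(1)[OF assms(2,3)] fin_dim_at[OF assms(3)]] .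

sublocale ranked_lattice subreps le "\<lambda>A B x. A x \<inter> B x"
  "\<lambda>A B x. A x <+>\<^bsub>space_at V x\<^esub> B x" "\<lambda>x. {\<zero>\<^bsub>space_at V x\<^esub>}" "\<lambda>x. carrier (space_at V x)"
  rank degree
proof (unfold_locales, goal_cases)
  \<comment> \<open>Cases are numbered by the assumptions of \<open>ranked_lattice\<close>: 8 to 10
    are the join laws, 12 and 14 the bounds, 15 to 17 monotonicity and congruence, 18 and 19
    modularity, 20 finiteness.\<close>
  case (8 A B)
  then show ?case by (auto simp: le_def intro: subspace_set_add(2) subrepD(1) del: subsetI)
next
  case (9 A B)
  then show ?case by (auto simp: le_def intro: subspace_set_add(3) subrepD(1) del: subsetI)
next
  case (10 A B C)
  then show ?case by (auto simp: le_def intro: set_add_subset[OF subrepD(1)] del: subsetI)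
next
  case (12 A)
  then show ?case
    by (auto simp: le_def intro: vectorspace.zero_in_subspace[OF vectorspace_at] subrepD(1))
next
  case (14 A)
  then show ?case
    by (auto simp: le_def intro: vectorspace.subspace_subset_carrier[OF vectorspace_at] subrepD(1)
        del: subsetI)
next
  case (15 A B)
  then show ?case by (auto simp: rank_def le_def intro!: sum_mono sdim_mono(1))
next
  case (16 A B)
  then have "sdim A x = sdim B x" if "x \<in> verts Q" for x
    using sum_mono_inv[of "sdim A" "verts Q" "sdim B" x] that finite_verts sdim_mono(1)
    by (simp add: rank_def le_def)
  then have "A x = B x" if "x \<in> verts Q" for x
    using 16 that sdim_mono(2)[of A B x] by (simp add: le_def)
  then show ?case by (simp add: le_def)
next
  case (17 A B)
  then have "A x = B x" if "x \<in> verts Q" for x using that by (auto simp: le_def)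
  then show ?case by (simp add: degree_def sdim_def)
next
  case (18 A B)
  then show ?case by (simp add: rank_def sum.distrib[symmetric] sdim_modular)
next
  case (19 A B)
  then have "real (sdim (\<lambda>x. A x <+>\<^bsub>space_at V x\<^esub> B x) x) + real (sdim (\<lambda>x. A x \<inter> B x) x) =
      real (sdim A x) + real (sdim B x)" if "x \<in> verts Q" for x
    using sdim_modular[of A B x] that by simp
  then show ?case
    by (simp add: degree_def sum.distrib[symmetric] distrib_left[symmetric])
next
  case 20
  \<comment> \<open>The degree depends on \<open>A\<close> only through its dimension vector, which
    lies in this finite box.\<close>
  let ?P = "\<Pi>\<^sub>E x\<in>verts Q. {..sdim (\<lambda>x. carrier (space_at V x)) x}"
  have "restrict (sdim A) (verts Q) \<in> ?P" if "subrep K Q V A" for A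
    using that sdim_mono(1)[OF that subrep_top]
      vectorspace.subspace_subset_carrier[OF vectorspace_at subrepD(1)] by auto
  moreover have "degree A = (\<Sum>x\<in>verts Q. \<alpha> x * real (restrict (sdim A) (verts Q) x))" for A
    by (simp add: degree_def)
  ultimately have "degree ` subreps \<subseteq> (\<lambda>f. \<Sum>x\<in>verts Q. \<alpha> x * real (f x)) ` ?P" by blast
  moreover have "finite ?P" using finite_verts by (intro finite_PiE) auto
  ultimately show ?case by (meson finite_imageI finite_subset)
qed (auto simp: le_def subrep_inter subrep_sum subrep_bot subrep_top)

end

text \<open>What \<open>quiver_rep\<close> says about vertices alone. It suffices to read
  nonvanishing off dimensions, and is what gets established for layers and their subobjects.\<close>

definition fin_dim_spaces ::
  "('k, 'm) ring_scheme \<Rightarrow> ('v, 'e) pre_digraph \<Rightarrow> ('v, 'e, 'k, 'b) rep \<Rightarrow> bool" where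
  "fin_dim_spaces K Q R \<longleftrightarrow>
    (\<forall>x\<in>verts Q. vectorspace K (space_at R x) \<and> vectorspace.fin_dim K (space_at R x))"

lemma nonzero_rep_iff:
  assumes "fin_dim_spaces K Q R" and "finite (verts Q)"
  shows "nonzero_rep Q R \<longleftrightarrow> 0 < (\<Sum>x\<in>verts Q. dimension_vector K Q R x)"
proof -
  have "carrier (space_at R x) = {\<zero>\<^bsub>space_at R x\<^esub>} \<longleftrightarrow> vectorspace.dim K (space_at R x) = 0"
    if "x \<in> verts Q" for x
  proof -
    interpret vectorspace K "space_at R x" using assms that by (simp add: fin_dim_spaces_def)
    have fd: fin_dim using assms that by (simp add: fin_dim_spaces_def)
    show ?thesis
    proof
      assume zero: "carrier (space_at R x) = {\<zero>\<^bsub>space_at R x\<^esub>}"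
      have "vectorspace.dim K (vs (carrier (space_at R x))) = 0"
        unfolding zero by (rule dim_zero_space)
      then show "dim = 0" by simp
    qed (rule carrier_eq_if_dim_zero[OF fd])
  qed
  moreover have "0 < (\<Sum>x\<in>verts Q. dimension_vector K Q R x) \<longleftrightarrow>
      (\<exists>x\<in>verts Q. dimension_vector K Q R x \<noteq> 0)"
    using sum_eq_0_iff[OF assms(2), of "dimension_vector K Q R"] by (metis neq0_conv)
  ultimately show ?thesis
    by (simp add: nonzero_rep_def dimension_vector_def)
qed

lemma fin_dim_spaces_sub_rep:
  assumes "fin_dim_spaces K Q R" and "\<And>x. x \<in> verts Q \<Longrightarrow> subspace K (U x) (space_at R x)"
  shows "fin_dim_spaces K Q (sub_rep R U)"
  unfolding fin_dim_spaces_def sub_rep_def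
proof (intro ballI)
  fix x assume x: "x \<in> verts Q"
  interpret vectorspace K "space_at R x" using assms(1) x by (simp add: fin_dim_spaces_def)
  have "fin_dim" using assms(1) x by (simp add: fin_dim_spaces_def)
  then show "vectorspace K (space_at \<lparr>space_at = \<lambda>x. (space_at R x)\<lparr>carrier := U x\<rparr>, map_at = map_at R\<rparr> x) \<and>
      vectorspace.fin_dim K (space_at \<lparr>space_at = \<lambda>x. (space_at R x)\<lparr>carrier := U x\<rparr>, map_at = map_at R\<rparr> x)"
    using subspace_is_vs[OF assms(2)[OF x]] subspace_fin_dim[OF assms(2)[OF x]] by simp
qed

lemma dimension_vector_sub_rep:
  "x \<in> verts Q \<Longrightarrow> dimension_vector K Q (sub_rep R U) x =
    vectorspace.dim K ((space_at R x)\<lparr>carrier := U x\<rparr>)"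
  by (simp add: dimension_vector_def sub_rep_def)

section \<open>Subrepresentations of B/A and subrepresentations between A and B\<close>

context charged_rep
begin

context
  fixes A B
  assumes A: "subrep K Q V A" and B: "subrep K Q V B" and AB: "le A B"
begin

abbreviation "layer \<equiv> quotient_rep Q (sub_rep V B) A"

abbreviation "space_B x \<equiv> (space_at V x)\<lparr>carrier := B x\<rparr>"

abbreviation "proj x \<equiv> (\<lambda>v. A x +>\<^bsub>space_B x\<^esub> v)"

lemma space_B:
  assumes "x \<in> verts Q"
  shows "vectorspace K (space_B x)" "vectorspace.fin_dim K (space_B x)"
    "subspace K (A x) (space_B x)"
proof -
  interpret V: vectorspace K "space_at V x" using assms by (rule vectorspace_at)
  have Bx: "subspace K (B x) (space_at V x)" using B assms by (rule subrepD(1))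
  show "vectorspace K (space_B x)" using Bx by (rule V.subspace_is_vs)
  show "vectorspace.fin_dim K (space_B x)"
    using V.subspace_fin_dim[OF Bx] fin_dim_at[OF assms] by simp
  show "subspace K (A x) (space_B x)"
    using V.subspace_of_subspace_iff[OF Bx] subrepD(1)[OF A assms] AB assms by (simp add: le_def)
qed

lemma space_at_layer: "space_at layer x = quotient_space (space_B x) (A x)"
  by (simp add: quotient_rep_def sub_rep_def)

lemma linear_map_proj: "x \<in> verts Q \<Longrightarrow> linear_map K (space_B x) (space_at layer x) (proj x)"
  unfolding space_at_layer by (rule quotient_linear_map) (rule space_B)

lemma proj_surj: "proj x ` B x = carrier (space_at layer x)"
  using quotient_space_surj[of "space_B x" "A x"] by (simp add: space_at_layer)

lemma proj_zero_iff: "x \<in> verts Q \<Longrightarrow> v \<in> B x \<Longrightarrow> proj x v = \<zero>\<^bsub>space_at layer x\<^esub> \<longleftrightarrow> v \<in> A x"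
  unfolding space_at_layer using quotient_space_zero_iff[OF space_B(3)] by simp

lemma fin_dim_spaces_layer: "fin_dim_spaces K Q layer"
  unfolding fin_dim_spaces_def
proof (intro ballI conjI)
  fix x assume x: "x \<in> verts Q"
  interpret linear_map K "space_B x" "space_at layer x" "proj x" using x by (rule linear_map_proj)
  show "vectorspace K (space_at layer x)" ..
  show "W.fin_dim" using surj_fin_dim[OF space_B(2)[OF x]] proj_surj by simp
qed

text \<open>The arrow of the quotient is defined as a union over all representatives of a coset.
  They differ by elements of \<open>A\<close>, which the arrow maps into \<open>A\<close> again, so
  the union is one coset.\<close>

lemma map_at_layer:
  assumes e: "e \<in> arcs Q" and v: "v \<in> B (tail Q e)"
  shows "map_at layer e (proj (tail Q e) v) = proj (head Q e) (map_at V e v)"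
proof -
  let ?s = "tail Q e" and ?t = "head Q e"
  have st: "?s \<in> verts Q" "?t \<in> verts Q" using e tail_head_in_verts by auto
  interpret e: linear_map K "space_at V ?s" "space_at V ?t" "map_at V e" using e by (rule linear_map_at)
  interpret s: linear_map K "space_B ?s" "space_at layer ?s" "proj ?s" using st(1) by (rule linear_map_proj)
  interpret t: linear_map K "space_B ?t" "space_at layer ?t" "proj ?t" using st(2) by (rule linear_map_proj)
  interpret As: abelian_subgroup "A ?s" "space_B ?s"
    using space_B[OF st(1)] by (intro vectorspace.abelian_subgroup_subspace)
  have sub: "A ?s \<subseteq> carrier (space_at V ?s)" "B ?s \<subseteq> carrier (space_at V ?s)" "A ?t \<subseteq> B ?t"
    using e.V.subspace_subset_carrier subrepD(1) A B st AB by (auto simp: le_def)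
  have "proj ?t (map_at V e u) = proj ?t (map_at V e v)" if u: "u \<in> proj ?s v" for u
  proof -
    obtain a where a: "a \<in> A ?s" "u = a \<oplus>\<^bsub>space_at V ?s\<^esub> v"
      using u by (auto simp: a_r_coset_def')
    then have ev: "map_at V e u = map_at V e a \<oplus>\<^bsub>space_at V ?t\<^esub> map_at V e v"
      using e.f_add[of a v] sub v by (simp add: subset_iff)
    have ea: "map_at V e a \<in> A ?t" using subrepD(2)[OF A e a(1)] .
    then have eaB: "map_at V e a \<in> B ?t" and evB: "map_at V e v \<in> B ?t"
      using sub subrepD(2)[OF B e v] by auto
    have "proj ?t (map_at V e u) = proj ?t (map_at V e a) \<oplus>\<^bsub>space_at layer ?t\<^esub> proj ?t (map_at V e v)"
      using t.f_add[of "map_at V e a" "map_at V e v"] eaB evB by (simp add: ev)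
    also have "proj ?t (map_at V e a) = \<zero>\<^bsub>space_at layer ?t\<^esub>"
      using proj_zero_iff[OF st(2) eaB] ea by simp
    finally show ?thesis using t.f_im[of "map_at V e v"] evB by simp
  qed
  moreover have "v \<in> proj ?s v" using v As.a_rcos_self[of v] by simp
  ultimately have "(\<Union>u\<in>proj ?s v. proj ?t (map_at V e u)) = proj ?t (map_at V e v)" by blast
  then show ?thesis by (simp add: quotient_rep_def sub_rep_def)
qed

text \<open>The additive form avoids truncated subtraction; \<open>sum_layer_dims\<close> passes to
  the reals before subtracting.\<close>

lemma dimension_layer_image:
  assumes C: "subrep K Q V C" and "le A C" "le C B" and x: "x \<in> verts Q"
  shows "dimension_vector K Q (sub_rep layer (\<lambda>x. proj x ` C x)) x + sdim A x = sdim C x"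
proof -
  interpret V: vectorspace K "space_at V x" using x by (rule vectorspace_at)
  have "subspace K (C x) (space_B x)"
    using V.subspace_of_subspace_iff[OF subrepD(1)[OF B x]] subrepD(1)[OF C x] assms by (simp add: le_def)
  then have "vectorspace.dim K ((space_B x)\<lparr>carrier := C x\<rparr>) =
      vectorspace.dim K ((quotient_space (space_B x) (A x))\<lparr>carrier := proj x ` C x\<rparr>) +
      vectorspace.dim K ((space_B x)\<lparr>carrier := A x\<rparr>)"
    using assms space_B[OF x] by (intro dim_quotient_image) (simp_all add: le_def)
  then show ?thesis by (simp add: dimension_vector_sub_rep x sdim_def space_at_layer)
qed

lemma dimension_layer:
  assumes x: "x \<in> verts Q"
  shows "dimension_vector K Q layer x + sdim A x = sdim B x"
proof -
  have "dimension_vector K Q (sub_rep layer (\<lambda>x. proj x ` B x)) x = dimension_vector K Q layer x"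
    unfolding dimension_vector_sub_rep[OF x] proj_surj using x by (simp add: dimension_vector_def)
  then show ?thesis using dimension_layer_image[OF B AB le_refl x] by simp
qed

lemma subrep_layer_image:
  assumes C: "subrep K Q V C" and "le A C" "le C B"
  shows "subrep K Q layer (\<lambda>x. proj x ` C x)"
  unfolding subrep_def
proof (intro conjI ballI)
  fix x assume x: "x \<in> verts Q"
  interpret V: vectorspace K "space_at V x" using x by (rule vectorspace_at)
  interpret p: linear_map K "space_B x" "space_at layer x" "proj x" using x by (rule linear_map_proj)
  have "subspace K (C x) (space_B x)"
    using V.subspace_of_subspace_iff[OF subrepD(1)[OF B x]] subrepD(1)[OF C x] assms x
    by (simp add: le_def)
  then show "subspace K (proj x ` C x) (space_at layer x)" by (rule p.subspace_image)
next
  fix e assume e: "e \<in> arcs Q"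
  then have sub: "C (tail Q e) \<subseteq> B (tail Q e)" using assms tail_head_in_verts by (auto simp: le_def)
  have "map_at layer e (proj (tail Q e) v) \<in> proj (head Q e) ` C (head Q e)"
    if v: "v \<in> C (tail Q e)" for v
  proof -
    have "v \<in> B (tail Q e)" using v sub by blast
    from map_at_layer[OF e this] subrepD(2)[OF C e v] show ?thesis by (metis imageI)
  qed
  then show "map_at layer e ` proj (tail Q e) ` C (tail Q e) \<subseteq> proj (head Q e) ` C (head Q e)"
    by blast
qed

text \<open>\<open>C\<close> is the preimage of \<open>U\<close> under the projections. It contains
  \<open>A\<close> because \<open>U\<close> contains zero, and its image is all of \<open>U\<close>
  because the projections are onto.\<close>

lemma subrep_layer_preimage:
  assumes U: "subrep K Q layer U"
  shows "\<exists>C. subrep K Q V C \<and> le A C \<and> le C B \<and> (\<forall>x\<in>verts Q. U x = proj x ` C x)"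
proof (intro exI conjI ballI)
  let ?C = "\<lambda>x. {v \<in> B x. proj x v \<in> U x}"
  have Ux: "subspace K (U x) (space_at layer x)" if "x \<in> verts Q" for x
    using U that by (simp add: subrep_def)
  show "subrep K Q V ?C"
    unfolding subrep_def
  proof (intro conjI ballI)
    fix x assume x: "x \<in> verts Q"
    interpret V: vectorspace K "space_at V x" using x by (rule vectorspace_at)
    interpret p: linear_map K "space_B x" "space_at layer x" "proj x" using x by (rule linear_map_proj)
    have "subspace K (?C x) (space_B x)" using p.subspace_preimage[OF Ux[OF x]] by simp
    then show "subspace K (?C x) (space_at V x)"
      using V.subspace_of_subspace_iff[OF subrepD(1)[OF B x]] by simp
  next
    fix e assume e: "e \<in> arcs Q"
    then have "map_at layer e c \<in> U (head Q e)" if "c \<in> U (tail Q e)" for c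
      using U that unfolding subrep_def by blast
    then have "proj (head Q e) (map_at V e v) \<in> U (head Q e)"
      if "v \<in> B (tail Q e)" "proj (tail Q e) v \<in> U (tail Q e)" for v
      using map_at_layer[OF e that(1)] that(2) by metis
    then show "map_at V e ` ?C (tail Q e) \<subseteq> ?C (head Q e)"
      using subrepD(2)[OF B e] by blast
  qed
  show "le ?C B" by (auto simp: le_def)
  show "le A ?C"
    unfolding le_def
  proof (intro ballI subsetI)
    fix x v assume x: "x \<in> verts Q" and v: "v \<in> A x"
    then have "v \<in> B x" using AB by (auto simp: le_def)
    moreover have "proj x v = \<zero>\<^bsub>space_at layer x\<^esub>" using proj_zero_iff x v calculation by simp
    moreover have "\<zero>\<^bsub>space_at layer x\<^esub> \<in> U x"
      using Ux[OF x] by (simp add: subspace_def submodule_def)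
    ultimately show "v \<in> ?C x" by simp
  qed
  show "U x = proj x ` ?C x" if x: "x \<in> verts Q" for x
  proof -
    have "U x \<subseteq> proj x ` B x" using Ux[OF x] by (simp add: proj_surj subspace_def submodule_def)
    then show ?thesis by blast
  qed
qed

text \<open>Stated for any \<open>R\<close> with the dimensions of C/A, to serve both the layer
  itself and the image of \<open>C\<close> inside it.\<close>

lemma sum_layer_dims:
  assumes "\<And>x. x \<in> verts Q \<Longrightarrow> dimension_vector K Q R x + sdim A x = sdim C x"
  shows "(\<Sum>x\<in>verts Q. dimension_vector K Q R x) + rank A = rank C"
    and "slope K Q \<alpha> R = incline A C"
proof -
  show sum: "(\<Sum>x\<in>verts Q. dimension_vector K Q R x) + rank A = rank C"
    using assms by (simp add: rank_def flip: sum.distrib)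
  have "real (dimension_vector K Q R x) = real (sdim C x) - real (sdim A x)" if "x \<in> verts Q" for x
    using assms[OF that] by simp
  then have "(\<Sum>x\<in>verts Q. \<alpha> x * real (dimension_vector K Q R x)) = degree C - degree A"
    by (simp add: degree_def right_diff_distrib sum_subtractf)
  moreover have "(\<Sum>x\<in>verts Q. real (dimension_vector K Q R x)) = real (rank C) - real (rank A)"
    unfolding sum[symmetric] by simp
  ultimately show "slope K Q \<alpha> R = incline A C" by (simp add: slope_def incline_def)
qed

lemma slope_layer: "slope K Q \<alpha> layer = incline A B"
  using dimension_layer by (rule sum_layer_dims)

lemma semistable_layer_iff: "semistable K Q \<alpha> layer \<longleftrightarrow> stable A B"
proof -
  have nz: "nonzero_rep Q layer \<longleftrightarrow> rank A < rank B"
    unfolding nonzero_rep_iff[OF fin_dim_spaces_layer finite_verts]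
    using sum_layer_dims(1)[OF dimension_layer] by linarith
  have sub: "nonzero_rep Q (sub_rep layer (\<lambda>x. proj x ` C x)) \<longleftrightarrow> rank A < rank C"
    "slope K Q \<alpha> (sub_rep layer (\<lambda>x. proj x ` C x)) = incline A C"
    if "subrep K Q V C" "le A C" "le C B" for C
  proof -
    have "fin_dim_spaces K Q (sub_rep layer (\<lambda>x. proj x ` C x))"
      using fin_dim_spaces_layer subrep_layer_image[OF that]
      by (intro fin_dim_spaces_sub_rep) (auto simp: subrep_def)
    note * = nonzero_rep_iff[OF this finite_verts] sum_layer_dims[OF dimension_layer_image[OF that]]
    show "nonzero_rep Q (sub_rep layer (\<lambda>x. proj x ` C x)) \<longleftrightarrow> rank A < rank C"
      unfolding *(1) using *(2) by linarith
    show "slope K Q \<alpha> (sub_rep layer (\<lambda>x. proj x ` C x)) = incline A C"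
      using *(3) .
  qed
  \<comment> \<open>A given \<open>U\<close> coincides with the image of its preimage only on
    \<open>verts Q\<close>, so invariance under changes elsewhere is needed.\<close>
  have cong: "nonzero_rep Q (sub_rep layer U) = nonzero_rep Q (sub_rep layer U')"
    "slope K Q \<alpha> (sub_rep layer U) = slope K Q \<alpha> (sub_rep layer U')"
    if "\<And>x. x \<in> verts Q \<Longrightarrow> U x = U' x" for U U'
    using that by (simp_all add: nonzero_rep_def sub_rep_def slope_def dimension_vector_def)
  show ?thesis
  proof
    assume ss: "semistable K Q \<alpha> layer"
    have "incline A C \<le> incline A B" if C: "subrep K Q V C" "le A C" "le C B" "rank A < rank C" for C
    proof -
      have "slope K Q \<alpha> (sub_rep layer (\<lambda>x. proj x ` C x)) \<le> slope K Q \<alpha> layer"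
        using ss subrep_layer_image[OF C(1-3)] sub(1)[OF C(1-3)] C(4) unfolding semistable_def by blast
      then show ?thesis unfolding sub(2)[OF C(1-3)] slope_layer .
    qed
    then show "stable A B" using ss nz AB by (simp add: stable_def semistable_def)
  next
    assume st: "stable A B"
    have "slope K Q \<alpha> (sub_rep layer U) \<le> slope K Q \<alpha> layer"
      if U: "subrep K Q layer U" "nonzero_rep Q (sub_rep layer U)" for U
    proof -
      obtain C where C: "subrep K Q V C" "le A C" "le C B"
        and eq: "\<forall>x\<in>verts Q. U x = proj x ` C x"
        using subrep_layer_preimage[OF U(1)] by blast
      note eq = bspec[OF eq]
      have "rank A < rank C" using U(2) cong(1)[OF eq] sub(1)[OF C] by simp
      then have "incline A C \<le> incline A B" using st C by (simp add: stable_def)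
      then show ?thesis using cong(2)[OF eq] sub(2)[OF C] slope_layer by simp
    qed
    then show "semistable K Q \<alpha> layer" using st nz by (simp add: semistable_def stable_def)
  qed
qed

end

end

section \<open>Harder-Narasimhan types and the rank invariant\<close>

context charged_rep
begin

lemma le_antisym_iff: "le A B \<and> le B A \<longleftrightarrow> (\<forall>x\<in>verts Q. A x = B x)"
  by (auto simp: le_def)

text \<open>The bridge from the lattice to representations. Strict inclusion of consecutive members
  needs no counterpart in \<open>hn_chain\<close>: a stable step raises the rank, so its ends differ
  at some vertex.\<close>

lemma HN_filtration_iff:
  "HN_filtration K Q \<alpha> V n F \<longleftrightarrow> hn_chain n F \<and> le_equiv (F 0) (\<lambda>x. {\<zero>\<^bsub>space_at V x\<^esub>})"
proof (cases "\<forall>k\<le>n. subrep K Q V (F k)")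
  case True
  have layer: "semistable K Q \<alpha> (filtration_quotient Q V F (Suc k)) \<longleftrightarrow> stable (F k) (F (Suc k))"
    "slope K Q \<alpha> (filtration_quotient Q V F (Suc k)) = incline (F k) (F (Suc k))"
    if "k < n" "le (F k) (F (Suc k))" for k
    using True that semistable_layer_iff[of "F k" "F (Suc k)"] slope_layer[of "F k" "F (Suc k)"]
    by (simp_all add: filtration_quotient_def)
  \<comment> \<open>Layers are numbered from 1, steps of a chain from 0.\<close>
  have range: "(\<forall>k\<in>{1..n}. P k) \<longleftrightarrow> (\<forall>k<n. P (Suc k))" for P
    unfolding image_Suc_lessThan[symmetric] by auto
  have range': "(\<forall>k\<in>{1..<n}. P k) \<longleftrightarrow> (\<forall>k. Suc k < n \<longrightarrow> P (Suc k))" for P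
  proof (intro iffI ballI allI impI)
    fix k assume "\<forall>k. Suc k < n \<longrightarrow> P (Suc k)" "k \<in> {1..<n}"
    then show "P k" by (cases k) auto
  qed auto
  have ne: "stable (F k) (F (Suc k)) \<Longrightarrow> k < n \<Longrightarrow> \<exists>x\<in>verts Q. F k x \<noteq> F (Suc k) x" for k
    using True r_cong[of "F k" "F (Suc k)"] by (auto simp: stable_def le_equiv_def le_def)
  have st: "stable (F k) (F (Suc k)) \<Longrightarrow> le (F k) (F (Suc k))" for k
    by (simp add: stable_def)
  show ?thesis
  proof
    assume "HN_filtration K Q \<alpha> V n F"
    note * = this[unfolded HN_filtration_def range range']
    then have inc: "le (F k) (F (Suc k))" if "k < n" for k using that by (simp add: le_def)
    show "hn_chain n F \<and> le_equiv (F 0) (\<lambda>x. {\<zero>\<^bsub>space_at V x\<^esub>})"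
      unfolding hn_chain_def
      using * layer inc by (simp add: le_equiv_def le_antisym_iff)
  next
    assume *: "hn_chain n F \<and> le_equiv (F 0) (\<lambda>x. {\<zero>\<^bsub>space_at V x\<^esub>})"
    then have stab: "stable (F k) (F (Suc k))" if "k < n" for k using that by (simp add: hn_chain_def)
    show "HN_filtration K Q \<alpha> V n F"
      unfolding HN_filtration_def range range'
      using * True layer stab st ne
      by (simp add: hn_chain_def le_equiv_def le_antisym_iff) (simp add: le_def)
  qed
next
  case False
  then show ?thesis by (auto simp: HN_filtration_def hn_chain_def)
qed

lemma HN_filtration_exists: "\<exists>n F. HN_filtration K Q \<alpha> V n F"
  using exists_hn_chain_from[OF bot_in] unfolding HN_filtration_iff by (metis le_equiv_def le_refl)

lemma HN_type_eq:
  assumes "HN_filtration K Q \<alpha> V n F"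
  shows "HN_type K Q \<alpha> V = map (\<lambda>k. dimension_vector K Q (filtration_quotient Q V F k)) [1..<n + 1]"
  unfolding HN_type_def
proof (rule the_equality)
  fix T
  assume "\<exists>n F. HN_filtration K Q \<alpha> V n F \<and>
        T = map (\<lambda>k. dimension_vector K Q (filtration_quotient Q V F k)) [1..<n + 1]"
  then obtain m G where G: "HN_filtration K Q \<alpha> V m G"
    and T: "T = map (\<lambda>k. dimension_vector K Q (filtration_quotient Q V G k)) [1..<m + 1]" by blast
  have nm: "n = m" and eq: "\<And>k. k \<le> n \<Longrightarrow> le_equiv (F k) (G k)"
    using hn_chain_unique[of n F m G] assms G unfolding HN_filtration_iff by auto
  \<comment> \<open>Uniqueness gives agreement at the vertices only, and the dimension of a layer at
    \<open>x\<close> depends on the filtration only through its values at \<open>x\<close>.\<close>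
  have "F k x = G k x" if "k \<le> n" "x \<in> verts Q" for k x
    using eq[OF that(1)] that(2) by (auto simp: le_equiv_def le_def)
  then have *: "dimension_vector K Q (filtration_quotient Q V F k) =
      dimension_vector K Q (filtration_quotient Q V G k)" if "k \<le> n" for k
    unfolding dimension_vector_def filtration_quotient_def quotient_rep_def sub_rep_def
    using that by (intro restrict_ext) simp
  show "T = map (\<lambda>k. dimension_vector K Q (filtration_quotient Q V F k)) [1..<n + 1]"
    unfolding T nm[symmetric] by (rule map_cong) (simp_all add: * del: upt_Suc)
qed (use assms in blast)

text \<open>The dimensions of the layers telescope, starting from the zero space
  \<open>F 0 x\<close>.\<close>

lemma sum_filtration_dims:
  assumes "HN_filtration K Q \<alpha> V n F" and "j \<le> n" and x: "x \<in> verts Q"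
  shows "(\<Sum>k = 1..j. dimension_vector K Q (filtration_quotient Q V F k) x) = sdim (F j) x"
  using assms(2)
proof (induction j)
  case 0
  have "F 0 x = {\<zero>\<^bsub>space_at V x\<^esub>}" using assms by (simp add: HN_filtration_def)
  then show ?case using x by (simp add: sdim_bot)
next
  case (Suc j)
  have chain: "hn_chain n F" using assms(1) HN_filtration_iff by blast
  then have "subrep K Q V (F j)" "subrep K Q V (F (Suc j))" "stable (F j) (F (Suc j))"
    using Suc.prems by (auto simp: hn_chain_def)
  then have "dimension_vector K Q (filtration_quotient Q V F (Suc j)) x + sdim (F j) x = sdim (F (Suc j)) x"
    using dimension_layer[of "F j" "F (Suc j)" x] x by (simp add: filtration_quotient_def stable_def)
  then show ?case using Suc by simp
qed

lemma degree_skyscraper: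
  assumes "x \<in> verts Q" "\<alpha> = skyscraper x"
  shows "degree A = real (sdim A x)"
proof -
  have "\<alpha> y * real (sdim A y) = (if y = x then real (sdim A y) else 0)" for y
    by (simp add: assms(2) skyscraper_def)
  then show ?thesis using assms(1) finite_verts by (simp add: degree_def)
qed

text \<open>Length 1 means that \<open>V\<close> itself is semistable. This form reduces telling the
  two square representations apart to dimension estimates on subrepresentations.\<close>

lemma length_HN_type_eq_1_iff:
  "length (HN_type K Q \<alpha> V) = 1 \<longleftrightarrow>
    0 < rank (\<lambda>x. carrier (space_at V x)) \<and>
    (\<forall>C. subrep K Q V C \<longrightarrow> 0 < rank C \<longrightarrow>
      degree C / real (rank C) \<le>
      degree (\<lambda>x. carrier (space_at V x)) / real (rank (\<lambda>x. carrier (space_at V x))))"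
proof -
  let ?bot = "\<lambda>x. {\<zero>\<^bsub>space_at V x\<^esub>}" and ?top = "\<lambda>x. carrier (space_at V x)"
  have bot: "rank ?bot = 0" "degree ?bot = 0" by (simp_all add: rank_def degree_def sdim_bot)
  have "length (HN_type K Q \<alpha> V) = 1 \<longleftrightarrow> stable ?bot ?top"
  proof
    assume len: "length (HN_type K Q \<alpha> V) = 1"
    obtain n F where F: "HN_filtration K Q \<alpha> V n F" using HN_filtration_exists by blast
    then have "n = 1" using HN_type_eq[OF F] len by (simp del: upt_Suc)
    then have "stable (F 0) (F 1)" "\<forall>x\<in>verts Q. F 0 x = ?bot x" "\<forall>x\<in>verts Q. F 1 x = ?top x"
      using F unfolding HN_filtration_iff by (auto simp: hn_chain_def le_equiv_def le_antisym_iff)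
    moreover from this have "rank (F 0) = rank ?bot" "degree (F 0) = degree ?bot"
      "rank (F 1) = rank ?top" "degree (F 1) = degree ?top"
      by (simp_all add: rank_def degree_def sdim_def)
    ultimately show "stable ?bot ?top"
      by (simp add: stable_def incline_def le_def)
  next
    assume st: "stable ?bot ?top"
    let ?F = "\<lambda>k :: nat. if k = 0 then ?bot else ?top"
    have F: "HN_filtration K Q \<alpha> V 1 ?F"
      unfolding HN_filtration_iff using st subrep_bot subrep_top
      by (simp add: hn_chain_def le_equiv_def le_refl)
    show "length (HN_type K Q \<alpha> V) = 1" unfolding HN_type_eq[OF F] by simp
  qed
  also have "\<dots> \<longleftrightarrow> 0 < rank ?top \<and>
    (\<forall>C. subrep K Q V C \<longrightarrow> 0 < rank C \<longrightarrow> degree C / real (rank C) \<le> degree ?top / real (rank ?top))"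
    using bot_le[of ?top] top_in by (auto simp: stable_def incline_def bot bot_le le_top)
  finally show ?thesis .
qed

section \<open>Spanning subrepresentations and skyscraper charges\<close>

lemma spanning_subrep_least:
  assumes "x \<in> verts Q"
  shows "subrep K Q V (spanning_subrep K Q V x)"
    and "spanning_subrep K Q V x x = carrier (space_at V x)"
    and "subrep K Q V W \<Longrightarrow> W x = carrier (space_at V x) \<Longrightarrow> spanning_subrep K Q V x y \<subseteq> W y"
proof -
  let ?F = "{W. subrep K Q V W \<and> W x = carrier (space_at V x)}"
  \<comment> \<open>The family is nonempty; an intersection over the empty family would be the whole
    type.\<close>
  have top: "(\<lambda>x. carrier (space_at V x)) \<in> ?F" using subrep_top by simp
  have eq: "spanning_subrep K Q V x y = (\<Inter>W\<in>?F. W y)" for y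
    by (auto simp: spanning_subrep_def)
  show "spanning_subrep K Q V x x = carrier (space_at V x)"
    using top unfolding eq by auto
  show "subrep K Q V W \<Longrightarrow> W x = carrier (space_at V x) \<Longrightarrow> spanning_subrep K Q V x y \<subseteq> W y"
    unfolding eq by blast
  show "subrep K Q V (spanning_subrep K Q V x)"
    unfolding subrep_def[of K Q V "spanning_subrep K Q V x"]
  proof (intro conjI ballI)
    fix y assume y: "y \<in> verts Q"
    have sub: "subspace K (W y) (space_at V y)" if "W \<in> ?F" for W
      using that subrepD(1)[OF _ y] by simp
    have sm: "submodule K (W y) (space_at V y)" if "W \<in> ?F" for W
      using sub[OF that] by (simp add: subspace_def)
    have "submodule K (\<Inter>W\<in>?F. W y) (space_at V y)"
    proof (rule submodule.intro)
      show "Module.module K (space_at V y)" using sm[OF top] by (simp add: submodule_def)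
      show "(\<Inter>W\<in>?F. W y) \<subseteq> carrier (space_at V y)" using top by blast
      show "v \<oplus>\<^bsub>space_at V y\<^esub> w \<in> (\<Inter>W\<in>?F. W y)" if "v \<in> (\<Inter>W\<in>?F. W y)" "w \<in> (\<Inter>W\<in>?F. W y)" for v w
        using that submodule.m_closed[OF sm] by blast
      show "\<zero>\<^bsub>space_at V y\<^esub> \<in> (\<Inter>W\<in>?F. W y)"
        using submodule.zero_closed[OF sm] by blast
      show "c \<odot>\<^bsub>space_at V y\<^esub> v \<in> (\<Inter>W\<in>?F. W y)" if "c \<in> carrier K" "v \<in> (\<Inter>W\<in>?F. W y)" for c v
        using that submodule.smult_closed[OF sm] by blast
    qed
    then show "subspace K (spanning_subrep K Q V x y) (space_at V y)"
      unfolding eq using vectorspace_at[OF y] by (simp add: subspace_def)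
  next
    fix e assume e: "e \<in> arcs Q"
    have "map_at V e v \<in> W (head Q e)" if "W \<in> ?F" "v \<in> W (tail Q e)" for W v
      using that subrepD(2)[of W e v] e by simp
    then show "map_at V e ` spanning_subrep K Q V x (tail Q e) \<subseteq> spanning_subrep K Q V x (head Q e)"
      unfolding eq by blast
  qed
qed

end

text \<open>With \<open>t = 0\<close> the potential is the dimension at \<open>x\<close>. What has
  to be located is the member of the chain where the inclines stop being positive, and that is
  \<open>F j\<close>: the space at \<open>x\<close> still grows in the step into \<open>F j\<close>
  and is constant from there on.\<close>

lemma HN_filtration_skyscraper:
  assumes "charged_rep K Q V" and x: "x \<in> verts Q"
    and F: "HN_filtration K Q (skyscraper x) V n F" and y: "y \<in> verts Q"
  defines "j \<equiv> LEAST j. j \<le> n \<and> F j x = carrier (space_at V x)"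
  shows "j \<le> n" "F j y = spanning_subrep K Q V x y"
proof -
  interpret charged_rep K Q V "skyscraper x" by (rule assms(1))
  have chain: "hn_chain n F" "le_equiv (F 0) (\<lambda>x. {\<zero>\<^bsub>space_at V x\<^esub>})"
    using F unfolding HN_filtration_iff by auto
  have degree: "degree A = real (sdim A x)" for A using x by (simp add: degree_skyscraper)
  have sub: "subrep K Q V (F i)" if "i \<le> n" for i using chain_in[OF chain that] by simp
  have "n \<le> n \<and> F n x = carrier (space_at V x)" using F x by (simp add: HN_filtration_def)
  then have j: "j \<le> n \<and> F j x = carrier (space_at V x)" unfolding j_def by (rule LeastI)
  then show "j \<le> n" by simp
  have lt: "F i x \<noteq> carrier (space_at V x)" if "i < j" for i
    using not_less_Least[OF that[unfolded j_def]] j that by auto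
  have rank: "rank (F i) < rank (F (Suc i))" if "i < n" for i
    using chain_rank_mono[OF chain, of i "Suc i"] that by simp
  have "least_maximizer 0 (F j)"
  proof (rule chain_least_maximizer[OF chain])
    show "j \<le> n" using j by simp
    show "0 < incline (F i) (F (Suc i))" if i: "i < j" for i
    proof -
      \<comment> \<open>The step into \<open>F j\<close> enlarges the space at \<open>x\<close>,
        since \<open>j\<close> is the first index where it is full. Its incline is therefore
        positive, and earlier steps are steeper still.\<close>
      define m where "m = j - 1"
      have m: "m < j" "Suc m = j" "m < n" using i j by (auto simp: m_def)
      have "F m x \<subseteq> F j x" using chain_le[OF chain, of m j] m j x unfolding le_def by auto
      then have "sdim (F m) x \<le> sdim (F j) x" "sdim (F m) x \<noteq> sdim (F j) x"
        using sdim_mono[OF sub sub x, of m j] lt[OF m(1)] m j by auto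
      then have "0 < incline (F m) (F (Suc m))"
        using rank[OF m(3)] m by (simp add: incline_def degree)
      then show ?thesis
        using chain_incline_antimono[OF chain, of i m] i m by (cases "i = m") auto
    qed
    show "incline (F i) (F (Suc i)) \<le> 0" if i: "j \<le> i" "i < n" for i
    proof -
      have "F k x = carrier (space_at V x)" if "j \<le> k" "k \<le> n" for k
      proof -
        have "F j x \<subseteq> F k x" "F k x \<subseteq> carrier (space_at V x)"
          using chain_le[OF chain that] le_top[of "F k"] sub[OF that(2)] x by (auto simp: le_def)
        then show ?thesis using j by simp
      qed
      then have "F i x = F (Suc i) x" using i by simp
      then show ?thesis by (simp add: incline_def degree sdim_def)
    qed
  qed
  moreover note S = spanning_subrep_least[OF x]
  \<comment> \<open>The spanning subrepresentation also attains the maximum, so it contains the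
    least maximizer \<open>F j\<close>; the other inclusion is its own minimality.\<close>
  have "potential 0 (spanning_subrep K Q V x) = potential 0 (F j)"
    using S(2) j by (simp add: potential_def degree sdim_def)
  ultimately have "le (F j) (spanning_subrep K Q V x)"
    using S(1) by (simp add: least_maximizer_def)
  then show "F j y = spanning_subrep K Q V x y"
    using S(3)[OF sub, of j y] j y by (auto simp: le_def)
qed

lemma rank_invariant_HN_sum:
  assumes "fin_digraph Q" "quiver_rep K Q V" and x: "x \<in> verts Q"
    and F: "HN_filtration K Q (skyscraper x) V n F" and y: "y \<in> verts Q"
  shows "rank_invariant K Q V (x, y) =
    (\<Sum>k = 1..(LEAST j. j \<le> n \<and> F j x = carrier (space_at V x)).
      dimension_vector K Q (filtration_quotient Q V F k) y)"
proof -
  interpret charged_rep K Q V "skyscraper x" using assms(1,2) by (rule charged_rep.intro)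
  note * = HN_filtration_skyscraper[OF charged_rep_axioms x F y]
  have "rank_invariant K Q V (x, y) = sdim (spanning_subrep K Q V x) y"
    using x y by (simp add: rank_invariant_def dimension_vector_sub_rep sdim_def)
  then show ?thesis
    unfolding sum_filtration_dims[OF F *(1) y] sdim_def *(2) .
qed

text \<open>Recognizes from dimensions alone the index at which the space at \<open>x\<close> is
  full. This lets two representations with equal types share the upper limit of the sum.\<close>

lemma carrier_reached_iff:
  assumes "fin_digraph Q" "quiver_rep K Q V" and x: "x \<in> verts Q"
    and F: "HN_filtration K Q \<alpha> V n F" and j: "j \<le> n"
  shows "F j x = carrier (space_at V x) \<longleftrightarrow>
    (\<Sum>k = 1..j. dimension_vector K Q (filtration_quotient Q V F k) x) =
    (\<Sum>k = 1..n. dimension_vector K Q (filtration_quotient Q V F k) x)"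
proof -
  interpret charged_rep K Q V \<alpha> using assms(1,2) by (rule charged_rep.intro)
  have chain: "hn_chain n F" "le_equiv (F 0) (\<lambda>x. {\<zero>\<^bsub>space_at V x\<^esub>})"
    using F unfolding HN_filtration_iff by auto
  have "F n x = carrier (space_at V x)" using F x by (simp add: HN_filtration_def)
  moreover have "F j x \<subseteq> F n x" using chain_le[OF chain j] x by (simp add: le_def)
  moreover have "subrep K Q V (F j)" "subrep K Q V (F n)" using chain_in[OF chain] j by auto
  ultimately have "F j x = carrier (space_at V x) \<longleftrightarrow> sdim (F j) x = sdim (F n) x"
    using sdim_mono(2)[of "F j" "F n" x] x unfolding sdim_def by metis
  then show ?thesis
    unfolding sum_filtration_dims[OF F j x] sum_filtration_dims[OF F order_refl x] .
qed

text \<open>\<open>V\<close> and \<open>V'\<close> may have carriers in different types, so their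
  filtrations are compared only through dimension vectors.\<close>

theorem skyscraper_finer_than_rank:
  assumes Q: "fin_digraph Q" and V: "quiver_rep K Q V" and V': "quiver_rep K Q V'"
    and eq: "skyscraper_invariant K Q V = skyscraper_invariant K Q V'"
  shows "rank_invariant K Q V = rank_invariant K Q V'"
proof -
  have "rank_invariant K Q V (x, y) = rank_invariant K Q V' (x, y)"
    if x: "x \<in> verts Q" and y: "y \<in> verts Q" for x y
  proof -
    interpret V: charged_rep K Q V "skyscraper x" using Q V by (rule charged_rep.intro)
    interpret V': charged_rep K Q V' "skyscraper x" using Q V' by (rule charged_rep.intro)
    obtain n F where F: "HN_filtration K Q (skyscraper x) V n F" using V.HN_filtration_exists by blast
    obtain m G where G: "HN_filtration K Q (skyscraper x) V' m G" using V'.HN_filtration_exists by blast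
    have "HN_type K Q (skyscraper x) V = HN_type K Q (skyscraper x) V'"
      using fun_cong[OF eq, of x] x by (simp add: skyscraper_invariant_def)
    then have types: "map (\<lambda>k. dimension_vector K Q (filtration_quotient Q V F k)) [1..<n + 1] =
        map (\<lambda>k. dimension_vector K Q (filtration_quotient Q V' G k)) [1..<m + 1]"
      unfolding V.HN_type_eq[OF F] V'.HN_type_eq[OF G] .
    have m: "m = n" using arg_cong[OF types, of length] by (simp del: upt_Suc)
    have "dimension_vector K Q (filtration_quotient Q V F k) =
        dimension_vector K Q (filtration_quotient Q V' G k)" if "1 \<le> k" "k \<le> n" for k
      using types that unfolding m map_eq_conv by (simp del: upt_Suc)
    then have dims: "(\<Sum>k = 1..j. dimension_vector K Q (filtration_quotient Q V F k) z) =
        (\<Sum>k = 1..j. dimension_vector K Q (filtration_quotient Q V' G k) z)" if "j \<le> n" for j z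
      using that by (intro sum.cong) auto
    have "(j \<le> n \<and> F j x = carrier (space_at V x)) = (j \<le> m \<and> G j x = carrier (space_at V' x))" for j
      using carrier_reached_iff[OF Q V x F, of j] carrier_reached_iff[OF Q V' x G, of j]
        dims[of j x] dims[of n x] m by auto
    then have least: "(LEAST j. j \<le> n \<and> F j x = carrier (space_at V x)) =
        (LEAST j. j \<le> m \<and> G j x = carrier (space_at V' x))" by simp
    have "(LEAST j. j \<le> n \<and> F j x = carrier (space_at V x)) \<le> n"
      using HN_filtration_skyscraper(1)[OF V.charged_rep_axioms x F y] .
    then show ?thesis
      unfolding rank_invariant_HN_sum[OF Q V x F y] rank_invariant_HN_sum[OF Q V' x G y] least[symmetric]
      using dims by blast
  qed
  then show ?thesis by (auto simp: rank_invariant_def fun_eq_iff restrict_def)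
qed

section \<open>Coordinate representations\<close>

text \<open>The power of \<open>K\<close> indexed by \<open>I\<close>, as functions supported on
  \<open>I\<close>. All index sets share one type and the same operations, so an inclusion of index
  sets is a literal inclusion of carriers.\<close>

definition coord_space :: "('k, 'm) ring_scheme \<Rightarrow> nat set \<Rightarrow> ('k, nat \<Rightarrow> 'k) module" where
  "coord_space K I =
     \<lparr>carrier = {f. \<forall>i. f i \<in> carrier K \<and> (i \<notin> I \<longrightarrow> f i = \<zero>\<^bsub>K\<^esub>)},
      mult = (\<lambda>f g. f), one = (\<lambda>i. \<zero>\<^bsub>K\<^esub>), zero = (\<lambda>i. \<zero>\<^bsub>K\<^esub>),
      add = (\<lambda>f g i. f i \<oplus>\<^bsub>K\<^esub> g i), smult = (\<lambda>c f i. c \<otimes>\<^bsub>K\<^esub> f i)\<rparr>"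

definition coord_proj :: "('k, 'm) ring_scheme \<Rightarrow> nat set \<Rightarrow> (nat \<Rightarrow> 'k) \<Rightarrow> nat \<Rightarrow> 'k" where
  "coord_proj K J f i = (if i \<in> J then f i else \<zero>\<^bsub>K\<^esub>)"

definition coord_rep ::
  "('k, 'm) ring_scheme \<Rightarrow> ('v, 'e) pre_digraph \<Rightarrow> ('v \<Rightarrow> nat set) \<Rightarrow> ('v, 'e, 'k, nat \<Rightarrow> 'k) rep" where
  "coord_rep K Q I = \<lparr>space_at = (\<lambda>x. coord_space K (I x)), map_at = (\<lambda>e. coord_proj K (I (head Q e)))\<rparr>"

lemma space_at_coord_rep [simp]: "space_at (coord_rep K Q I) x = coord_space K (I x)"
  and map_at_coord_rep [simp]: "map_at (coord_rep K Q I) e = coord_proj K (I (head Q e))"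
  by (simp_all add: coord_rep_def)

lemma vectorspace_coord_space:
  assumes "field K"
  shows "vectorspace K (coord_space K I)"
proof -
  interpret field K by fact
  show ?thesis
  proof (rule vs_criteria)
    show "\<forall>v\<in>carrier (coord_space K I). \<exists>w\<in>carrier (coord_space K I).
        v \<oplus>\<^bsub>coord_space K I\<^esub> w = \<zero>\<^bsub>coord_space K I\<^esub>"
    proof
      fix v assume "v \<in> carrier (coord_space K I)"
      then show "\<exists>w\<in>carrier (coord_space K I). v \<oplus>\<^bsub>coord_space K I\<^esub> w = \<zero>\<^bsub>coord_space K I\<^esub>"
        by (intro bexI[of _ "\<lambda>i. \<ominus>\<^bsub>K\<^esub> v i"]) (auto simp: coord_space_def r_neg)
    qed
  qed (auto simp: coord_space_def assms m_assoc l_distr r_distr a_assoc fun_eq_iff intro: a_comm)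
qed

lemma coord_space_mono: "I \<subseteq> J \<Longrightarrow> carrier (coord_space K I) \<subseteq> carrier (coord_space K J)"
  by (auto simp: coord_space_def)

lemma coord_space_update: "(coord_space K J)\<lparr>carrier := carrier (coord_space K I)\<rparr> = coord_space K I"
  by (simp add: coord_space_def)

lemma subspace_coord_space:
  assumes "field K" "I \<subseteq> J"
  shows "subspace K (carrier (coord_space K I)) (coord_space K J)"
proof -
  interpret I: vectorspace K "coord_space K I" using assms(1) by (rule vectorspace_coord_space)
  interpret J: vectorspace K "coord_space K J" using assms(1) by (rule vectorspace_coord_space)
  have ops: "add (coord_space K J) = add (coord_space K I)" "zero (coord_space K J) = zero (coord_space K I)"
    "smult (coord_space K J) = smult (coord_space K I)"
    by (simp_all add: coord_space_def)
  show ?thesis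
    unfolding subspace_def submodule_def ops
    using coord_space_mono[OF assms(2)] J.vectorspace_axioms J.module.module_axioms by simp
qed

lemma linear_map_coord_proj:
  assumes "field K" "J \<subseteq> I"
  shows "linear_map K (coord_space K I) (coord_space K J) (coord_proj K J)"
proof -
  interpret field K by fact
  have "coord_proj K J \<in> module_hom K (coord_space K I) (coord_space K J)"
    by (auto simp: module_hom_def coord_proj_def coord_space_def fun_eq_iff)
  then show ?thesis
    using vectorspace_coord_space[OF assms(1)]
    by (simp add: linear_map_def mod_hom_def mod_hom_axioms_def vectorspace_def)
qed

lemma coord_proj_surj:
  assumes "field K" "J \<subseteq> I"
  shows "coord_proj K J ` carrier (coord_space K I) = carrier (coord_space K J)"
proof -
  interpret field K by fact
  have "g = coord_proj K J g" if "g \<in> carrier (coord_space K J)" for g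
    using that by (auto simp: coord_proj_def coord_space_def)
  moreover have "coord_proj K J f \<in> carrier (coord_space K J)" if "f \<in> carrier (coord_space K I)" for f
    using that by (auto simp: coord_proj_def coord_space_def)
  ultimately show ?thesis using coord_space_mono[OF assms(2)] by blast
qed

definition unit_vector :: "('k, 'm) ring_scheme \<Rightarrow> nat \<Rightarrow> nat \<Rightarrow> 'k" where
  "unit_vector K i j = (if j = i then \<one>\<^bsub>K\<^esub> else \<zero>\<^bsub>K\<^esub>)"

lemma gen_set_unit_vectors:
  assumes "field K" "finite I"
  shows "unit_vector K ` I \<subseteq> carrier (coord_space K I)"
    and "module.span K (coord_space K I) (unit_vector K ` I) = carrier (coord_space K I)"
proof -
  interpret V: vectorspace K "coord_space K I" using assms(1) by (rule vectorspace_coord_space)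
  interpret field K by fact
  show U: "unit_vector K ` I \<subseteq> carrier (coord_space K I)"
    by (auto simp: unit_vector_def coord_space_def)
  have sub: "submodule K (V.span (unit_vector K ` I)) (coord_space K I)"
    using U by (rule V.span_is_submodule)
  have "carrier (coord_space K J) \<subseteq> V.span (unit_vector K ` I)" if "J \<subseteq> I" for J
    using finite_subset[OF that assms(2)] that
  proof (induction J rule: finite_induct)
    case empty
    have "f = \<zero>\<^bsub>coord_space K I\<^esub>" if "f \<in> carrier (coord_space K {})" for f
      using that by (auto simp: coord_space_def)
    then show ?case using submodule.zero_closed[OF sub] by auto
  next
    case (insert i J)
    show ?case
    proof
      fix f assume f: "f \<in> carrier (coord_space K (insert i J))"
      then have "coord_proj K J f \<in> carrier (coord_space K J)"
        by (auto simp: coord_space_def coord_proj_def)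
      then have g: "coord_proj K J f \<in> V.span (unit_vector K ` I)" using insert by auto
      have "unit_vector K i \<in> unit_vector K ` I" using insert.prems by simp
      then have "unit_vector K i \<in> V.span (unit_vector K ` I)"
        using V.in_own_span[OF U] by (rule subsetD[rotated])
      moreover have "f i \<in> carrier K" using f by (simp add: coord_space_def)
      ultimately have h: "f i \<odot>\<^bsub>coord_space K I\<^esub> unit_vector K i \<in> V.span (unit_vector K ` I)"
        by (intro submodule.smult_closed[OF sub])
      have "f = coord_proj K J f \<oplus>\<^bsub>coord_space K I\<^esub> (f i \<odot>\<^bsub>coord_space K I\<^esub> unit_vector K i)"
        using f insert.hyps(2) by (auto simp: coord_space_def coord_proj_def unit_vector_def fun_eq_iff)
      then show "f \<in> V.span (unit_vector K ` I)"
        using submodule.m_closed[OF sub g h] by simp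
    qed
  qed
  then show "V.span (unit_vector K ` I) = carrier (coord_space K I)"
    using submodule.subset[OF sub] by blast
qed

lemma fin_dim_coord_space:
  assumes "field K" "finite I"
  shows "vectorspace.fin_dim K (coord_space K I)"
proof -
  interpret V: vectorspace K "coord_space K I" using assms(1) by (rule vectorspace_coord_space)
  show ?thesis
    unfolding V.fin_dim_def
    using gen_set_unit_vectors[OF assms] assms(2) by (intro exI[of _ "unit_vector K ` I"]) simp
qed

lemma dim_coord_space_singleton:
  assumes "field K"
  shows "vectorspace.dim K (coord_space K {i}) = 1"
proof -
  interpret V: vectorspace K "coord_space K {i}" using assms by (rule vectorspace_coord_space)
  interpret field K by fact
  have "unit_vector K i \<noteq> \<zero>\<^bsub>coord_space K {i}\<^esub>"
    using one_not_zero by (auto simp: coord_space_def unit_vector_def dest!: fun_cong[of _ _ i])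
  then show ?thesis
    using gen_set_unit_vectors[OF assms, of "{i}"] by (intro V.dim1I[of "unit_vector K i"]) simp_all
qed

lemma coord_proj_kernel:
  assumes "field K" "i \<notin> I"
  shows "{f \<in> carrier (coord_space K (insert i I)). coord_proj K {i} f = \<zero>\<^bsub>coord_space K {i}\<^esub>} =
    carrier (coord_space K I)"
  using assms(2) by (auto simp: coord_space_def coord_proj_def fun_eq_iff)

text \<open>Rank-nullity for the projection to one coordinate: its image is a line, its kernel the
  coordinate space of the remaining indices.\<close>

lemma dim_coord_space:
  assumes "field K" "finite I"
  shows "vectorspace.dim K (coord_space K I) = card I"
  using assms(2)
proof (induction I rule: finite_induct)
  case empty
  interpret V: vectorspace K "coord_space K {}" using assms(1) by (rule vectorspace_coord_space)
  interpret field K by fact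
  have zero: "carrier (coord_space K {}) = {\<zero>\<^bsub>coord_space K {}\<^esub>}"
    by (auto simp: coord_space_def)
  have "vectorspace.dim K (V.vs (carrier (coord_space K {}))) = 0"
    unfolding zero by (rule V.dim_zero_space)
  then show ?case by simp
next
  case (insert i I)
  interpret linear_map K "coord_space K (insert i I)" "coord_space K {i}" "coord_proj K {i}"
    by (rule linear_map_coord_proj[OF assms(1)]) simp
  have "V.fin_dim" using fin_dim_coord_space assms(1) insert.hyps by blast
  from dim_image[OF V.subspace_carrier this]
  have "V.dim = vectorspace.dim K (coord_space K {i}) + vectorspace.dim K (coord_space K I)"
    unfolding coord_proj_kernel[OF assms(1) insert.hyps(2)] coord_space_update
    by (simp add: coord_proj_surj[OF assms(1)])
  then show ?case using insert dim_coord_space_singleton[OF assms(1)] by simp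
qed

text \<open>Supports that shrink along arrows make every arrow a surjective projection.\<close>

locale coord_quiver =
  fixes K :: "('k, 'm) ring_scheme"
    and Q :: "('v, 'e) pre_digraph"
    and I :: "'v \<Rightarrow> nat set"
  assumes field: "field K" and fin_digraph: "fin_digraph Q"
    and finite_support: "x \<in> verts Q \<Longrightarrow> finite (I x)"
    and support_antimono: "e \<in> arcs Q \<Longrightarrow> I (head Q e) \<subseteq> I (tail Q e)"
begin

lemma quiver_rep_coord_rep: "quiver_rep K Q (coord_rep K Q I)"
  by (auto simp: quiver_rep_def
      intro!: vectorspace_coord_space linear_map_coord_proj fin_dim_coord_space field
      dest: finite_support support_antimono)

text \<open>An arrow kills the coordinates outside the support of its head, so only the surviving
  ones must stay in \<open>J\<close>.\<close>

lemma subrep_coord: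
  assumes "\<And>x. x \<in> verts Q \<Longrightarrow> J x \<subseteq> I x"
    and "\<And>e. e \<in> arcs Q \<Longrightarrow> J (tail Q e) \<inter> I (head Q e) \<subseteq> J (head Q e)"
  shows "subrep K Q (coord_rep K Q I) (\<lambda>x. carrier (coord_space K (J x)))"
  unfolding subrep_def
proof (intro conjI ballI)
  show "subspace K (carrier (coord_space K (J x))) (space_at (coord_rep K Q I) x)" if "x \<in> verts Q" for x
    using subspace_coord_space[OF field assms(1)[OF that]] by simp
next
  fix e assume e: "e \<in> arcs Q"
  have "\<zero>\<^bsub>K\<^esub> \<in> carrier K" using field by (simp add: field.is_ring ring.ring_simprules)
  then show "map_at (coord_rep K Q I) e ` carrier (coord_space K (J (tail Q e))) \<subseteq>
      carrier (coord_space K (J (head Q e)))"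
    using assms(2)[OF e] by (auto simp: coord_proj_def coord_space_def) blast
qed

text \<open>Upper bound: the full spaces at the vertices reachable from \<open>x\<close>, with zero
  elsewhere, form a subrepresentation. Lower bound: arrows are onto, so fullness at \<open>x\<close>
  propagates along directed paths.\<close>

lemma spanning_subrep_coord:
  assumes x: "x \<in> verts Q" and y: "y \<in> verts Q"
  shows "spanning_subrep K Q (coord_rep K Q I) x y =
    carrier (coord_space K (if x \<rightarrow>\<^sup>*\<^bsub>Q\<^esub> y then I y else {}))"
proof
  interpret Q: fin_digraph Q by (rule fin_digraph)
  interpret charged_rep K Q "coord_rep K Q I" \<alpha> for \<alpha> :: "'v \<Rightarrow> real"
    using fin_digraph quiver_rep_coord_rep by (rule charged_rep.intro)
  note S = spanning_subrep_least[OF x]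
  let ?S = "spanning_subrep K Q (coord_rep K Q I) x"
  let ?J = "\<lambda>y. if x \<rightarrow>\<^sup>*\<^bsub>Q\<^esub> y then I y else {}"
  have "subrep K Q (coord_rep K Q I) (\<lambda>y. carrier (coord_space K (?J y)))"
  proof (rule subrep_coord)
    fix e assume "e \<in> arcs Q"
    then have "tail Q e \<rightarrow>\<^bsub>Q\<^esub> head Q e" by (auto simp: arcs_ends_conv)
    then show "?J (tail Q e) \<inter> I (head Q e) \<subseteq> ?J (head Q e)"
      using Q.reachable_adj_trans by auto
  qed auto
  then show "?S y \<subseteq> carrier (coord_space K (?J y))"
    by (rule S(3)) (simp add: x)
  have "carrier (coord_space K (I y)) \<subseteq> ?S y" if "x \<rightarrow>\<^sup>*\<^bsub>Q\<^esub> y" for y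
    using that
  proof (induction rule: Q.reachable_induct)
    case base
    then show ?case using S(2) by simp
  next
    case (step y z)
    then obtain e where e: "e \<in> arcs Q" "tail Q e = y" "head Q e = z" by blast
    have "carrier (coord_space K (I z)) = coord_proj K (I z) ` carrier (coord_space K (I y))"
      using coord_proj_surj[OF field support_antimono[OF e(1)]] e by simp
    also have "\<dots> \<subseteq> ?S z"
      using step.IH subrepD(2)[OF S(1) e(1)] e by auto
    finally show ?case .
  qed
  moreover have "carrier (coord_space K {}) \<subseteq> ?S y"
  proof -
    have "\<zero>\<^bsub>coord_space K (I y)\<^esub> \<in> ?S y"
      using vectorspace.zero_in_subspace[OF vectorspace_at[OF y] subrepD(1)[OF S(1) y]]
      by simp
    moreover have "f = \<zero>\<^bsub>coord_space K (I y)\<^esub>" if "f \<in> carrier (coord_space K {})" for f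
      using that by (auto simp: coord_space_def)
    ultimately show ?thesis by auto
  qed
  ultimately show "carrier (coord_space K (?J y)) \<subseteq> ?S y" by simp
qed

lemma rank_invariant_coord_rep:
  "rank_invariant K Q (coord_rep K Q I) =
    (\<lambda>(x, y)\<in>verts Q \<times> verts Q. if x \<rightarrow>\<^sup>*\<^bsub>Q\<^esub> y then card (I y) else 0)"
  unfolding rank_invariant_def
proof (rule restrict_ext, clarify)
  fix x y assume xy: "x \<in> verts Q" "y \<in> verts Q"
  then have "dimension_vector K Q (sub_rep (coord_rep K Q I) (spanning_subrep K Q (coord_rep K Q I) x)) y =
      vectorspace.dim K (coord_space K (if x \<rightarrow>\<^sup>*\<^bsub>Q\<^esub> y then I y else {}))"
    by (simp add: dimension_vector_sub_rep spanning_subrep_coord coord_space_update)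
  then show "dimension_vector K Q (sub_rep (coord_rep K Q I) (spanning_subrep K Q (coord_rep K Q I) x)) y =
      (if x \<rightarrow>\<^sup>*\<^bsub>Q\<^esub> y then card (I y) else 0)"
    using finite_support xy field by (simp add: dim_coord_space)
qed

end

section \<open>Two representations of the square with the same rank invariant\<close>

text \<open>Keeps the coordinate index in the form 1, so that index sets such as {0, 1} are not
  rewritten with \<open>Suc 0\<close>.\<close>

declare One_nat_def [simp del]

text \<open>The parameter \<open>i\<close> is the coordinate of the plane at p that survives at r,
  while q always keeps coordinate 0. For \<open>i = 0\<close> the two kernels coincide; for
  \<open>i = 1\<close> they are complementary lines.\<close>

definition square_support :: "nat \<Rightarrow> square_vertex \<Rightarrow> nat set" where
  "square_support i v = (case v of Vp \<Rightarrow> {0, 1} | Vq \<Rightarrow> {0} | Vr \<Rightarrow> {i} | Vs \<Rightarrow> {})"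

abbreviation "square_rep K i \<equiv> coord_rep K square_quiver (square_support i)"

lemma square_support_simps [simp]:
  "square_support i Vp = {0, 1}" "square_support i Vq = {0}"
  "square_support i Vr = {i}" "square_support i Vs = {}"
  by (simp_all add: square_support_def)

lemma square_quiver_simps [simp]:
  "verts square_quiver = {Vp, Vq, Vr, Vs}"
  "arcs square_quiver = {(Vp, Vq), (Vp, Vr), (Vq, Vs), (Vr, Vs)}"
  "tail square_quiver = fst" "head square_quiver = snd"
  by (simp_all add: square_quiver_def)

lemma fin_digraph_square_quiver: "fin_digraph square_quiver"
  by unfold_locales auto

lemma coord_quiver_square:
  assumes "field K" "i \<in> {0, 1}"
  shows "coord_quiver K square_quiver (square_support i)"
  using assms fin_digraph_square_quiver by (auto simp: coord_quiver_def)

lemma rank_invariant_square_rep: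
  assumes "field K"
  shows "rank_invariant K square_quiver (square_rep K 0) = rank_invariant K square_quiver (square_rep K 1)"
proof -
  note rank = coord_quiver.rank_invariant_coord_rep[OF coord_quiver_square[OF assms]]
  have "rank_invariant K square_quiver (square_rep K 0) = (\<lambda>(x, y)\<in>verts square_quiver \<times> verts square_quiver.
      if x \<rightarrow>\<^sup>*\<^bsub>square_quiver\<^esub> y then card (square_support 0 y) else 0)"
    by (rule rank) simp
  moreover have "rank_invariant K square_quiver (square_rep K 1) = (\<lambda>(x, y)\<in>verts square_quiver \<times> verts square_quiver.
      if x \<rightarrow>\<^sup>*\<^bsub>square_quiver\<^esub> y then card (square_support 1 y) else 0)"
    by (rule rank) simp
  moreover have "card (square_support 0 y) = card (square_support 1 y)" for y
    by (cases y) simp_all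
  ultimately show ?thesis by (simp only:)
qed

lemma charged_rep_square_rep:
  assumes "field K" "i \<in> {0, 1}"
  shows "charged_rep K square_quiver (square_rep K i)"
  using fin_digraph_square_quiver coord_quiver.quiver_rep_coord_rep[OF coord_quiver_square[OF assms]]
  by (rule charged_rep.intro)

lemma sdim_top_square_rep:
  assumes "field K" "i \<in> {0, 1}" "v \<in> verts square_quiver"
  shows "charged_rep.sdim K (square_rep K i) (\<lambda>x. carrier (coord_space K (square_support i x))) v =
    card (square_support i v)"
proof -
  interpret charged_rep K square_quiver "square_rep K i" "\<lambda>_. 0" by (rule charged_rep_square_rep) fact+
  have "finite (square_support i v)" by (cases v) simp_all
  then show ?thesis by (simp add: sdim_def dim_coord_space assms(1))
qed

text \<open>The whole representation has dimensions 2, 1, 1, 0, so its slope is 1/2. Semistability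
  thus asks that the space of a subrepresentation at p be at most half of its total dimension, which
  holds because it embeds into the sum of the spaces at q and r.\<close>

lemma HN_type_square_rep_1:
  assumes "field K"
  shows "length (HN_type K square_quiver (skyscraper Vp) (square_rep K 1)) = 1"
proof -
  interpret charged_rep K square_quiver "square_rep K 1" "skyscraper Vp"
    by (rule charged_rep_square_rep[OF assms]) simp
  have degree: "degree A = real (sdim A Vp)" for A
    by (rule degree_skyscraper) simp_all
  have rank: "rank A = sdim A Vp + sdim A Vq + sdim A Vr + sdim A Vs" for A
    by (simp add: rank_def)
  have top: "sdim (\<lambda>x. carrier (coord_space K (square_support 1 x))) v = card (square_support 1 v)" for v
    using sdim_top_square_rep[OF assms, of 1 v] by (cases v) simp_all
  \<comment> \<open>The two projections of \<open>C Vp\<close> have no common kernel.\<close>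
  have bound: "sdim C Vp \<le> sdim C Vq + sdim C Vr" if C: "subrep K square_quiver (square_rep K 1) C" for C
  proof -
    interpret q: linear_map K "coord_space K {0, 1}" "coord_space K {0}" "coord_proj K {0}"
      by (rule linear_map_coord_proj[OF assms]) simp
    interpret r: linear_map K "coord_space K {0, 1}" "coord_space K {1}" "coord_proj K {1}"
      by (rule linear_map_coord_proj[OF assms]) simp
    \<comment> \<open>Rank-nullity is applied twice: \<open>C Vp\<close> maps into
      \<open>C Vq\<close> with kernel \<open>?N\<close>, and \<open>?N\<close> maps injectively into
      \<open>C Vr\<close>.\<close>
    let ?N = "{v \<in> C Vp. coord_proj K {0} v = \<zero>\<^bsub>coord_space K {0}\<^esub>}"
    have Cp: "subspace K (C Vp) (coord_space K {0, 1})" and Cq: "subspace K (C Vq) (coord_space K {0})"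
      and Cr: "subspace K (C Vr) (coord_space K {1})"
      using subrepD(1)[OF C, of Vp] subrepD(1)[OF C, of Vq] subrepD(1)[OF C, of Vr]
      by simp_all
    have sub: "C Vp \<subseteq> carrier (coord_space K {0, 1})" using q.V.subspace_subset_carrier[OF Cp] .
    have q: "coord_proj K {0} ` C Vp \<subseteq> C Vq" and r: "coord_proj K {1} ` C Vp \<subseteq> C Vr"
      using subrepD(2)[OF C, of "(Vp, Vq)"] subrepD(2)[OF C, of "(Vp, Vr)"]
      by auto
    have fd: "vectorspace.fin_dim K (coord_space K I)" if "finite I" for I
      using fin_dim_coord_space[OF assms that] .
    have "?N = C Vp \<inter> {v \<in> carrier (coord_space K {0, 1}). coord_proj K {0} v \<in> {\<zero>\<^bsub>coord_space K {0}\<^esub>}}"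
      using sub by auto
    then have N: "subspace K ?N (coord_space K {0, 1})"
      using subspace_inter[OF Cp q.subspace_preimage[OF q.W.subspace_zero]] by simp
    have ker: "{v \<in> ?N. coord_proj K {1} v = \<zero>\<^bsub>coord_space K {1}\<^esub>} = {\<zero>\<^bsub>coord_space K {0, 1}\<^esub>}"
    proof
      show "{\<zero>\<^bsub>coord_space K {0, 1}\<^esub>} \<subseteq> {v \<in> ?N. coord_proj K {1} v = \<zero>\<^bsub>coord_space K {1}\<^esub>}"
        using q.V.zero_in_subspace[OF Cp] by (simp add: q.f0_is_0 r.f0_is_0)
      show "{v \<in> ?N. coord_proj K {1} v = \<zero>\<^bsub>coord_space K {1}\<^esub>} \<subseteq> {\<zero>\<^bsub>coord_space K {0, 1}\<^esub>}"
      proof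
        fix v assume v: "v \<in> {v \<in> ?N. coord_proj K {1} v = \<zero>\<^bsub>coord_space K {1}\<^esub>}"
        then have "coord_proj K {0} v 0 = \<zero>\<^bsub>K\<^esub>" "coord_proj K {1} v 1 = \<zero>\<^bsub>K\<^esub>"
          by (auto simp: coord_space_def)
        moreover have "v i = \<zero>\<^bsub>K\<^esub>" if "i \<notin> {0, 1}" for i
          using v sub that by (auto simp: coord_space_def)
        ultimately have "v i = \<zero>\<^bsub>K\<^esub>" for i
          by (cases "i \<in> {0, 1}") (auto simp: coord_proj_def)
        then show "v \<in> {\<zero>\<^bsub>coord_space K {0, 1}\<^esub>}" by (auto simp: coord_space_def fun_eq_iff)
      qed
    qed
    have "sdim C Vp = vectorspace.dim K (q.V.vs (C Vp))" "sdim C Vq = vectorspace.dim K (q.W.vs (C Vq))"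
      "sdim C Vr = vectorspace.dim K (r.W.vs (C Vr))"
      by (simp_all add: sdim_def)
    moreover have "vectorspace.dim K (q.V.vs (C Vp)) =
        vectorspace.dim K (q.W.vs (coord_proj K {0} ` C Vp)) + vectorspace.dim K (q.V.vs ?N)"
      by (rule q.dim_image[OF Cp fd]) simp
    moreover have "vectorspace.dim K (q.V.vs ?N) = vectorspace.dim K (r.W.vs (coord_proj K {1} ` ?N))"
      using r.dim_image[OF N fd] unfolding ker by (simp add: q.V.dim_zero_space)
    moreover have "vectorspace.dim K (q.W.vs (coord_proj K {0} ` C Vp)) \<le> vectorspace.dim K (q.W.vs (C Vq))"
      by (rule q.W.subspace_dim_mono(1)[OF q.subspace_image[OF Cp] Cq q fd]) simp
    moreover have "coord_proj K {1} ` ?N \<subseteq> C Vr" using r by blast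
    then have "vectorspace.dim K (r.W.vs (coord_proj K {1} ` ?N)) \<le> vectorspace.dim K (r.W.vs (C Vr))"
      by (rule r.W.subspace_dim_mono(1)[OF r.subspace_image[OF N] Cr _ fd]) simp
    ultimately show ?thesis by linarith
  qed
  have "degree C / real (rank C) \<le> 1 / 2" if "subrep K square_quiver (square_rep K 1) C" "0 < rank C" for C
  proof -
    have "2 * real (sdim C Vp) \<le> real (rank C)" using bound[OF that(1)] by (simp add: rank)
    then show ?thesis using that(2) by (simp add: degree field_simps)
  qed
  then show ?thesis
    unfolding length_HN_type_eq_1_iff by (simp add: degree rank top)
qed

lemma HN_type_square_rep_0:
  assumes "field K"
  shows "length (HN_type K square_quiver (skyscraper Vp) (square_rep K 0)) \<noteq> 1"
proof -
  interpret charged_rep K square_quiver "square_rep K 0" "skyscraper Vp"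
    by (rule charged_rep_square_rep[OF assms]) simp
  have degree: "degree A = real (sdim A Vp)" for A
    by (rule degree_skyscraper) simp_all
  have rank: "rank A = sdim A Vp + sdim A Vq + sdim A Vr + sdim A Vs" for A
    by (simp add: rank_def)
  have top: "sdim (\<lambda>x. carrier (coord_space K (square_support 0 x))) v = card (square_support 0 v)" for v
    using sdim_top_square_rep[OF assms, of 0 v] by (cases v) simp_all
  \<comment> \<open>Coordinate 1 spans the common kernel of the two arrows out of p. Its slope 1
    exceeds the slope 1/2 of the whole.\<close>
  define J where "J v = (if v = Vp then {1 :: nat} else {})" for v
  let ?C = "\<lambda>v. carrier (coord_space K (J v))"
  have sub: "subrep K square_quiver (square_rep K 0) ?C"
    by (rule coord_quiver.subrep_coord[OF coord_quiver_square[OF assms]]) (auto simp: J_def)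
  have "sdim ?C v = card (J v)" for v
    by (simp add: sdim_def coord_space_update dim_coord_space assms J_def)
  then have "degree ?C = 1" "rank ?C = 1" by (simp_all add: degree rank J_def)
  then show ?thesis
    unfolding length_HN_type_eq_1_iff using sub by (auto simp: degree rank top)
qed

lemma skyscraper_invariant_square_rep:
  assumes "field K"
  shows "skyscraper_invariant K square_quiver (square_rep K 0) \<noteq>
    skyscraper_invariant K square_quiver (square_rep K 1)"
proof
  assume "skyscraper_invariant K square_quiver (square_rep K 0) =
    skyscraper_invariant K square_quiver (square_rep K 1)"
  from fun_cong[OF this, of Vp] show False
    using HN_type_square_rep_0[OF assms] HN_type_square_rep_1[OF assms]
    by (simp add: skyscraper_invariant_def)
qed

theorem mainTheorem1:
  fixes K :: "('k, 'm) ring_scheme"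
    and Q :: "('v, 'e) pre_digraph"
  assumes "field K" and "fin_digraph Q"
  shows
    "(\<forall>(V :: ('v, 'e, 'k, 'b) rep) (V' :: ('v, 'e, 'k, 'c) rep).
        quiver_rep K Q V \<longrightarrow> quiver_rep K Q V' \<longrightarrow>
        skyscraper_invariant K Q V = skyscraper_invariant K Q V' \<longrightarrow>
        rank_invariant K Q V = rank_invariant K Q V')
     \<and>
     (\<forall>(V :: ('v, 'e, 'k, 'b) rep) x n F.
        quiver_rep K Q V \<longrightarrow> nonzero_rep Q V \<longrightarrow> x \<in> verts Q \<longrightarrow>
        HN_filtration K Q (skyscraper x) V n F \<longrightarrow>
        (\<forall>y\<in>verts Q. x \<rightarrow>\<^sup>*\<^bsub>Q\<^esub> y \<longrightarrow>
           rank_invariant K Q V (x, y) =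
             (\<Sum>k = 1..(LEAST j. j \<le> n \<and> F j x = carrier (space_at V x)).
                dimension_vector K Q (filtration_quotient Q V F k) y)))
     \<and>
     (\<exists>(W :: (square_vertex, square_vertex \<times> square_vertex, 'k, nat \<Rightarrow> 'k) rep)
        (W' :: (square_vertex, square_vertex \<times> square_vertex, 'k, nat \<Rightarrow> 'k) rep).
        quiver_rep K square_quiver W \<and> quiver_rep K square_quiver W' \<and>
        rank_invariant K square_quiver W = rank_invariant K square_quiver W' \<and>
        skyscraper_invariant K square_quiver W \<noteq> skyscraper_invariant K square_quiver W')"
proof (intro conjI allI impI ballI)
  show "rank_invariant K Q V = rank_invariant K Q V'"
    if "quiver_rep K Q V" "quiver_rep K Q V'"
      "skyscraper_invariant K Q V = skyscraper_invariant K Q V'"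
    for V :: "('v, 'e, 'k, 'b) rep" and V' :: "('v, 'e, 'k, 'c) rep"
    using assms(2) that by (rule skyscraper_finer_than_rank)
next
  fix V :: "('v, 'e, 'k, 'b) rep" and x n F y
  assume "quiver_rep K Q V" "x \<in> verts Q" "HN_filtration K Q (skyscraper x) V n F" "y \<in> verts Q"
  then show "rank_invariant K Q V (x, y) =
      (\<Sum>k = 1..(LEAST j. j \<le> n \<and> F j x = carrier (space_at V x)).
        dimension_vector K Q (filtration_quotient Q V F k) y)"
    using assms(2) by (intro rank_invariant_HN_sum)
next
  have "quiver_rep K square_quiver (square_rep K i)" if "i \<in> {0, 1}" for i
    using assms(1) that by (intro coord_quiver.quiver_rep_coord_rep coord_quiver_square)
  then show "\<exists>(W :: (square_vertex, square_vertex \<times> square_vertex, 'k, nat \<Rightarrow> 'k) rep)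
      (W' :: (square_vertex, square_vertex \<times> square_vertex, 'k, nat \<Rightarrow> 'k) rep).
      quiver_rep K square_quiver W \<and> quiver_rep K square_quiver W' \<and>
      rank_invariant K square_quiver W = rank_invariant K square_quiver W' \<and>
      skyscraper_invariant K square_quiver W \<noteq> skyscraper_invariant K square_quiver W'"
    using rank_invariant_square_rep[OF assms(1)] skyscraper_invariant_square_rep[OF assms(1)]
    by (intro exI[of _ "square_rep K 0"] exI[of _ "square_rep K 1"]) simp
qed

end
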